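(* Let $G$ be a right-filled graph with vertex set $[n]$, and regard $L_G$ as a poset on the set of $G$-forests. Let $T,T'\in L_G$. Then: (1) $T\le T'$ in $L_G$ if and only if $\mathrm{inv}(T)\subseteq\mathrm{inv}(T')$. (2) The poset of maximal tubings $L_G$ is isomorphic to the subposet of the weak order on $\mathfrak{S}_n$ induced by the set of $G$-permutations in $\mathfrak{S}_n$. In particular, $L_G$ is a lattice. (3) $\Psi_G:\mathfrak{S}_n\to L_G$ is a meet semilattice map; that is, for all $w,w'\in\mathfrak{S}_n$, $\Psi_G(w\wedge w')=\Psi_G(w)\wedge\Psi_G(w')$.
   Context: Write $[n]=\{1,\dots,n\}$; graphs are simple, and $G|_I$ is the induced subgraph on $I$. $G$ is right-filled if whenever $\{i,k\}$ is an edge and $i<j<k$, $\{j,k\}$ is an edge. A tube of $G$ is a nonempty $I\subseteq[n]$ with $G|_I$ connected. Tubes $I,J$ are compatible if they are nested or $I\cup J$ is not a tube. A maximal tubing is an inclusion-maximal set of pairwise compatible tubes. Each tube $I$ in a maximal tubing $\mathcal{X}$ contains a unique element $\mathrm{top}_{\mathcal{X}}(I)$ in no tube of $\mathcal{X}$ properly contained in $I$. If $\mathcal{Y}=(\mathcal{X}\setminus\{I\})\cup\{J\}$ are maximal tubings with $I\ne J$, write $\mathcal{X}\to\mathcal{Y}$ if $\mathrm{top}_{\mathcal{X}}(I)<\mathrm{top}_{\mathcal{Y}}(J)$; $L_G$ is the set of maximal tubings ordered by the reflexive transitive closure of $\to$. A forest poset $T$ on $[n]$ is a poset whose components are rooted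 trees with $i<_T k$ iff $i\ne k$ lie in the same component and the path from $i$ to the root passes through $k$. Let $i_\downarrow$ be the principal order ideal of $i$ in $T$. $T$ is a $G$-forest (a $G$-tree if connected) if each $i_\downarrow$ is a tube of $G$, and $i_\downarrow\cup k_\downarrow$ is not a tube whenever $i,k$ are incomparable in $T$. The map $\chi:T\mapsto\{i_\downarrow: i\in[n]\}$ is a bijection from $G$-forests to maximal tubings, and via $\chi$ the poset $L_G$ is regarded as a poset on $G$-forests: $T\le T'$ iff $\chi(T)\le\chi(T')$. A pair $(i,j)$ is an inversion of a $G$-forest $T$ if $i<j$ and $j<_T i$; $\mathrm{inv}(T)$ is the set of inversions of $T$. Weak order on $\mathfrak{S}_n$ (a lattice): $x\le y$ iff $\mathrm{inv}(x)\subseteq\mathrm{inv}(y)$, where $(i,k)$, $i<k$, is in $\mathrm{inv}(x)$ iff $k$ precedes $i$ in $x=x_1\cdots x_n$. A permutation $w$ is a $G$-permutation if for every $i$, $w_i$ and $\max\{w_1,\dots,w_i\}$ lie in the same connected component of $G|_{\{w_1,\dots,w_i\}}$. $\Psi_G(w)$ is the maximal tubing $\{X_1,\dots,X_n\}$ where $X_j$ is the vertex set of the connected component of $G|_{\{w_1,\dots,w_j\}}$ containing $w_j$. *)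

theory Defs
  imports "HOL-Algebra.Lattice" "HOL-Combinatorics.Permutations"
begin

text \<open>A simple graph on \<open>{1..n}\<close> is given by its symmetric, irreflexive adjacency relation.\<close>

definition simple_graph :: "nat \<Rightarrow> nat rel \<Rightarrow> bool" where
  "simple_graph n E \<longleftrightarrow> E \<subseteq> {1..n} \<times> {1..n} \<and> sym E \<and> irrefl E"

definition right_filled :: "nat rel \<Rightarrow> bool" where
  "right_filled E \<longleftrightarrow> (\<forall>i j k. (i, k) \<in> E \<and> i < j \<and> j < k \<longrightarrow> (j, k) \<in> E)"

text \<open>\<open>Restr E I\<close> is the adjacency relation of the subgraph induced on \<open>I\<close>.\<close>

definition connected_on :: "nat rel \<Rightarrow> nat set \<Rightarrow> bool" where
  "connected_on E I \<longleftrightarrow> I \<noteq> {} \<and> (\<forall>u\<in>I. \<forall>v\<in>I. (u, v) \<in> (Restr E I)\<^sup>*)"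

definition component_of :: "nat rel \<Rightarrow> nat set \<Rightarrow> nat \<Rightarrow> nat set" where
  "component_of E I v = {u \<in> I. v \<in> I \<and> (v, u) \<in> (Restr E I)\<^sup>*}"

definition tube :: "nat \<Rightarrow> nat rel \<Rightarrow> nat set \<Rightarrow> bool" where
  "tube n E I \<longleftrightarrow> I \<subseteq> {1..n} \<and> connected_on E I"

definition compatible :: "nat \<Rightarrow> nat rel \<Rightarrow> nat set \<Rightarrow> nat set \<Rightarrow> bool" where
  "compatible n E I J \<longleftrightarrow> I \<subseteq> J \<or> J \<subseteq> I \<or> \<not> tube n E (I \<union> J)"

definition tubing :: "nat \<Rightarrow> nat rel \<Rightarrow> nat set set \<Rightarrow> bool" where
  "tubing n E X \<longleftrightarrow> (\<forall>I\<in>X. tube n E I) \<and> (\<forall>I\<in>X. \<forall>J\<in>X. compatible n E I J)"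

definition maximal_tubing :: "nat \<Rightarrow> nat rel \<Rightarrow> nat set set \<Rightarrow> bool" where
  "maximal_tubing n E X \<longleftrightarrow> tubing n E X \<and> (\<forall>Y. tubing n E Y \<and> X \<subseteq> Y \<longrightarrow> Y = X)"

definition tube_top :: "nat set set \<Rightarrow> nat set \<Rightarrow> nat" where
  "tube_top X I = (THE i. i \<in> I \<and> (\<forall>J\<in>X. J \<subset> I \<longrightarrow> i \<notin> J))"

definition flip :: "nat \<Rightarrow> nat rel \<Rightarrow> nat set set \<Rightarrow> nat set set \<Rightarrow> bool" where
  "flip n E X Y \<longleftrightarrow> maximal_tubing n E X \<and> maximal_tubing n E Y \<and>
     (\<exists>I\<in>X. \<exists>J. I \<noteq> J \<and> Y = (X - {I}) \<union> {J} \<and> tube_top X I < tube_top Y J)"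

definition tubing_poset :: "nat \<Rightarrow> nat rel \<Rightarrow> nat set set gorder" where
  "tubing_poset n E = \<lparr>carrier = {X. maximal_tubing n E X}, eq = (=), le = (flip n E)\<^sup>*\<^sup>*\<rparr>"


text \<open>A poset on \<open>{1..n}\<close> is a reflexive order relation \<open>T\<close> with \<open>(i, k) \<in> T\<close> meaning \<open>i \<le> k\<close>; its
  graph-theoretic notions (components, paths, trees) refer to its undirected Hasse diagram.\<close>

definition hasse :: "nat rel \<Rightarrow> nat rel" where
  "hasse T = (let C = {(i, k) \<in> T. i \<noteq> k \<and> (\<forall>j. (i, j) \<in> T \<and> (j, k) \<in> T \<longrightarrow> j = i \<or> j = k)}
     in C \<union> C\<inverse>)"

definition simple_path :: "nat rel \<Rightarrow> nat \<Rightarrow> nat list \<Rightarrow> nat \<Rightarrow> bool" where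
  "simple_path E u p v \<longleftrightarrow> p \<noteq> [] \<and> hd p = u \<and> last p = v \<and> distinct p \<and>
     successively (\<lambda>a b. (a, b) \<in> E) p"

definition graph_cycle :: "nat rel \<Rightarrow> nat list \<Rightarrow> bool" where
  "graph_cycle E p \<longleftrightarrow> length p \<ge> 3 \<and> distinct p \<and> successively (\<lambda>a b. (a, b) \<in> E) p \<and>
     (last p, hd p) \<in> E"

definition tree_on :: "nat rel \<Rightarrow> nat set \<Rightarrow> bool" where
  "tree_on E C \<longleftrightarrow> connected_on E C \<and> \<not> (\<exists>p. set p \<subseteq> C \<and> graph_cycle E p)"

definition forest_poset :: "nat \<Rightarrow> nat rel \<Rightarrow> bool" where
  "forest_poset n T \<longleftrightarrow> partial_order_on {1..n} T \<and>
     (\<forall>C \<in> component_of (hasse T) {1..n} ` {1..n}.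
        tree_on (hasse T) C \<and>
        (\<exists>root\<in>C. \<forall>i\<in>C. \<forall>k\<in>{1..n}.
           (i, k) \<in> T \<and> i \<noteq> k \<longleftrightarrow>
           i \<noteq> k \<and> k \<in> C \<and> (\<exists>p. simple_path (hasse T) i p root \<and> k \<in> set p)))"

text \<open>The principal order ideal of \<open>i\<close> is \<open>under T i\<close>.\<close>

definition G_forest :: "nat \<Rightarrow> nat rel \<Rightarrow> nat rel \<Rightarrow> bool" where
  "G_forest n E T \<longleftrightarrow> forest_poset n T \<and>
     (\<forall>i\<in>{1..n}. tube n E (under T i)) \<and>
     (\<forall>i\<in>{1..n}. \<forall>k\<in>{1..n}. (i, k) \<notin> T \<and> (k, i) \<notin> T \<longrightarrow>
        \<not> tube n E (under T i \<union> under T k))"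

definition forest_tubing :: "nat \<Rightarrow> nat rel \<Rightarrow> nat set set" where
  "forest_tubing n T = under T ` {1..n}"

definition forest_order :: "nat \<Rightarrow> nat rel \<Rightarrow> nat rel gorder" where
  "forest_order n E = \<lparr>carrier = {T. G_forest n E T}, eq = (=),
     le = (\<lambda>T T'. forest_tubing n T \<sqsubseteq>\<^bsub>tubing_poset n E\<^esub> forest_tubing n T')\<rparr>"

definition forest_inv :: "nat rel \<Rightarrow> nat rel" where
  "forest_inv T = {(i, j). i < j \<and> (j, i) \<in> T}"


text \<open>The word \<open>w\<^sub>1 \<dots> w\<^sub>n\<close> is the function \<open>w\<close> with \<open>w permutes {1..n}\<close>; inversions are pairs of
  values, not of positions.\<close>

definition perm_inv :: "nat \<Rightarrow> (nat \<Rightarrow> nat) \<Rightarrow> nat rel" where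
  "perm_inv n w = {(i, k). i < k \<and> (\<exists>a\<in>{1..n}. \<exists>b\<in>{1..n}. a < b \<and> w a = k \<and> w b = i)}"

definition weak_order :: "nat \<Rightarrow> (nat \<Rightarrow> nat) gorder" where
  "weak_order n = \<lparr>carrier = {w. w permutes {1..n}}, eq = (=),
     le = (\<lambda>x y. perm_inv n x \<subseteq> perm_inv n y)\<rparr>"

definition G_permutation :: "nat \<Rightarrow> nat rel \<Rightarrow> (nat \<Rightarrow> nat) \<Rightarrow> bool" where
  "G_permutation n E w \<longleftrightarrow> w permutes {1..n} \<and>
     (\<forall>i\<in>{1..n}. Max (w ` {1..i}) \<in> component_of E (w ` {1..i}) (w i))"

definition Psi :: "nat \<Rightarrow> nat rel \<Rightarrow> (nat \<Rightarrow> nat) \<Rightarrow> nat set set" where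
  "Psi n E w = (\<lambda>j. component_of E (w ` {1..j}) (w j)) ` {1..n}"

definition poset_isomorphic :: "'a gorder \<Rightarrow> 'b gorder \<Rightarrow> bool" where
  "poset_isomorphic P Q \<longleftrightarrow> (\<exists>f. bij_betw f (carrier P) (carrier Q) \<and>
     (\<forall>x\<in>carrier P. \<forall>y\<in>carrier P. x \<sqsubseteq>\<^bsub>P\<^esub> y \<longleftrightarrow> f x \<sqsubseteq>\<^bsub>Q\<^esub> f y))"

end

theory Submission
  imports Defs
begin

text \<open>
  Every tubing is contained in some \<open>\<Psi>(w)\<close>, and these all have \<open>n\<close> elements, so they are exactly the
  maximal tubings. In a right-filled graph a vertex strictly between two vertices of a tube lies in
  the tube or is adjacent to it; hence incomparable tubes are separated and the inversion set of a
  maximal tubing is again the inversion set of a permutation, namely of the unique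
  \<open>G\<close>-permutation in the fibre of \<open>\<Psi>\<close>. The resulting map from permutations to \<open>G\<close>-permutations is
  an interior operator on the weak order, so its image is a lattice and the map preserves meets.

  A flip enlarges the inversion set of a tubing. Conversely, an adjacent transposition going up in
  the weak order either fixes \<open>\<Psi>(w)\<close> or flips it, so a saturated chain between two
  \<open>G\<close>-permutations maps to a sequence of flips between their tubings. Hence \<open>L\<^sub>G\<close> is inclusion of
  inversion sets.
\<close>

section \<open>Connected sets\<close>

text \<open>Right-filledness is one-sided: a detour through smaller vertices can be replaced by an
  edge at a larger one. Inversions fit it, since whether \<open>j > i\<close> lies in the tube with
  top \<open>i\<close> can be decided among the vertices from \<open>i\<close> upwards. This yields
  monotonicity both for \<open>Psi\<close> and for flips. The interior operator sends
  \<open>w\<close> to the permutation with inversion set \<open>tubing_inv n (Psi n E w)\<close>. It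
  shrinks, because the tube of \<open>i\<close> consists of vertices listed no later than
  \<open>i\<close>; it is idempotent, because the new permutation has the same tubing. As a map onto
  its fixed points such an operator is right adjoint to their inclusion: it preserves meets, and
  joins of fixed points are already the joins of the weak order. A single flip can add several
  inversions, so chains are built in the weak order, where each step adds exactly one.\<close>

lemma component_of_subset: "component_of E S v \<subseteq> S"
  by (auto simp: component_of_def)

lemma component_of_self: "v \<in> S \<Longrightarrow> v \<in> component_of E S v"
  by (auto simp: component_of_def)

lemma component_of_step:
  assumes "u \<in> component_of E S v" "(u, x) \<in> E" "x \<in> S"
  shows "x \<in> component_of E S v"
  using assms by (auto simp: component_of_def intro: rtrancl_into_rtrancl)

lemma component_of_trans:
  assumes "u \<in> component_of E S v"
  shows "component_of E S u \<subseteq> component_of E S v"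
  using assms by (auto simp: component_of_def)

lemma connected_subset_component_of:
  assumes "connected_on E I" "v \<in> I" "I \<subseteq> S"
  shows "I \<subseteq> component_of E S v"
proof
  fix u assume "u \<in> I"
  then have "(v, u) \<in> (Restr E I)\<^sup>*" using assms by (auto simp: connected_on_def)
  moreover have "Restr E I \<subseteq> Restr E S" using assms by auto
  ultimately have "(v, u) \<in> (Restr E S)\<^sup>*" using rtrancl_mono by blast
  then show "u \<in> component_of E S v" using assms \<open>u \<in> I\<close> by (auto simp: component_of_def)
qed

lemma component_of_mono: "S \<subseteq> S' \<Longrightarrow> component_of E S v \<subseteq> component_of E S' v"
  using rtrancl_mono[of "Restr E S" "Restr E S'"] by (auto simp: component_of_def)

lemma sym_Restr_rtrancl: "sym E \<Longrightarrow> sym ((Restr E S)\<^sup>*)"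
  by (intro sym_rtrancl) (auto simp: sym_def)

lemma connected_on_component_of:
  assumes "sym E" "v \<in> S"
  shows "connected_on E (component_of E S v)"
proof -
  let ?C = "component_of E S v"
  have *: "(v, u) \<in> (Restr E ?C)\<^sup>*" if "u \<in> ?C" for u
  proof -
    from that have "(v, u) \<in> (Restr E S)\<^sup>*" by (simp add: component_of_def)
    then show ?thesis
    proof (induction rule: rtrancl_induct)
      case (step y z)
      then have "y \<in> ?C" "z \<in> ?C" using assms(2)
        by (auto simp: component_of_def intro: rtrancl_into_rtrancl)
      then show ?case using step by (auto intro: rtrancl_into_rtrancl)
    qed simp
  qed
  show ?thesis unfolding connected_on_def
  proof (intro conjI ballI)
    show "?C \<noteq> {}" using component_of_self assms by blast
    fix x y assume "x \<in> ?C" "y \<in> ?C"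
    then show "(x, y) \<in> (Restr E ?C)\<^sup>*"
      using * sym_Restr_rtrancl[OF assms(1)] by (meson rtrancl_trans symD)
  qed
qed

lemma component_of_sym:
  assumes "sym E" "u \<in> component_of E S v"
  shows "component_of E S u = component_of E S v"
proof
  show "component_of E S u \<subseteq> component_of E S v" by (rule component_of_trans[OF assms(2)])
  have "v \<in> component_of E S u"
    using assms sym_Restr_rtrancl[OF assms(1)] by (auto simp: component_of_def dest: symD)
  then show "component_of E S v \<subseteq> component_of E S u" by (rule component_of_trans)
qed

lemma connected_on_crossing_edge:
  assumes "connected_on E I" "u \<in> I" "u \<in> A" "v \<in> I" "v \<notin> A"
  obtains x y where "x \<in> I" "x \<in> A" "y \<in> I" "y \<notin> A" "(x, y) \<in> E"
proof -
  have "(u, v) \<in> (Restr E I)\<^sup>*" using assms by (auto simp: connected_on_def)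
  then have "v \<in> A \<or> (\<exists>x y. x \<in> I \<and> x \<in> A \<and> y \<in> I \<and> y \<notin> A \<and> (x, y) \<in> E)"
    by (induction rule: rtrancl_induct) (use assms in auto)
  with assms that show ?thesis by blast
qed

text \<open>Everything is reachable from \<open>x\<close> inside the union: \<open>A\<close>
  directly, \<open>y\<close> by at most one edge, and all of \<open>B\<close> from \<open>y\<close>.
  So the component of \<open>x\<close> is the whole union.\<close>

lemma connected_on_Un:
  assumes "sym E" "connected_on E A" "connected_on E B" "x \<in> A" "y \<in> B" "x = y \<or> (x, y) \<in> E"
  shows "connected_on E (A \<union> B)"
proof -
  let ?C = "component_of E (A \<union> B) x"
  have A: "A \<subseteq> ?C" using assms by (intro connected_subset_component_of) auto
  then have "y \<in> ?C" using assms component_of_step by blast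
  then have "component_of E (A \<union> B) y \<subseteq> ?C" by (rule component_of_trans)
  moreover have "B \<subseteq> component_of E (A \<union> B) y"
    using assms by (intro connected_subset_component_of) auto
  ultimately have "?C = A \<union> B" using A component_of_subset by blast
  then show ?thesis using connected_on_component_of[OF assms(1), of x "A \<union> B"] assms by auto
qed

lemma connected_on_singleton: "connected_on E {v}"
  by (simp add: connected_on_def)

text \<open>A detour below \<open>b\<close> can be cut short: the edge re-entering \<open>{b..}\<close> from below ends at a
  neighbour of \<open>b\<close>.\<close>

lemma right_filled_component_of_atLeast:
  assumes "right_filled E" "connected_on E I" "b \<in> I" "j \<in> I" "b \<le> j"
  shows "j \<in> component_of E (I \<inter> {b..}) b"
proof -
  let ?C = "component_of E (I \<inter> {b..}) b"
  have b: "b \<in> ?C" using assms by (intro component_of_self) auto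
  have "(b, j) \<in> (Restr E I)\<^sup>*" using assms by (auto simp: connected_on_def)
  then have "b \<le> j \<longrightarrow> j \<in> ?C"
  proof (induction rule: rtrancl_induct)
    case (step y z)
    show ?case
    proof
      assume "b \<le> z"
      consider "b \<le> y" | "z = b" | "y < b" "b < z" using \<open>b \<le> z\<close> by linarith
      then show "z \<in> ?C"
      proof cases
        case 1
        then show ?thesis using step \<open>b \<le> z\<close> component_of_step[of y E _ b z] by auto
      next
        case 3
        then have "(b, z) \<in> E" using assms(1) step unfolding right_filled_def by blast
        then show ?thesis using step \<open>b \<le> z\<close> component_of_step[OF b] by auto
      qed (use b in simp)
    qed
  qed (use b in simp)
  then show ?thesis using assms by simp
qed

text \<open>A walk in \<open>I\<close> from \<open>i\<close> to \<open>k\<close> must jump over the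
  missing \<open>j\<close> along an edge \<open>(x, y)\<close> with \<open>x < j < y\<close>;
  right-filledness moves its smaller end to \<open>j\<close>.\<close>

lemma right_filled_adjacent:
  assumes "right_filled E" "connected_on E I" "i \<in> I" "k \<in> I" "i < j" "j < k" "j \<notin> I"
  obtains v where "v \<in> I" "(j, v) \<in> E"
proof -
  obtain x y where "x \<in> I" "x < j" "y \<in> I" "\<not> y < j" "(x, y) \<in> E"
    using connected_on_crossing_edge[OF assms(2), of i "{..<j}" k] assms by auto
  moreover from this have "j < y" using \<open>j \<notin> I\<close> by (cases "y = j") auto
  ultimately show ?thesis using that assms(1) unfolding right_filled_def by blast
qed

section \<open>Maximal tubings\<close>

text \<open>An injective \<open>q\<close> plays the role of \<open>w\<inverse>\<close>: it lists \<open>{1..n}\<close> by increasing \<open>q\<close>.\<close>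

definition prefix_component :: "nat \<Rightarrow> nat rel \<Rightarrow> (nat \<Rightarrow> nat) \<Rightarrow> nat \<Rightarrow> nat set" where
  "prefix_component n E q v = component_of E {u \<in> {1..n}. q u \<le> q v} v"

text \<open>For the tubing of a forest this is the principal ideal of \<open>i\<close>.\<close>

definition least_tube :: "nat set set \<Rightarrow> nat \<Rightarrow> nat set" where
  "least_tube X i = \<Inter>{I \<in> X. i \<in> I}"

text \<open>For the tubing of a forest this is \<open>forest_inv\<close>. Phrased on tubings, it can
  be compared with \<open>perm_inv\<close> and followed through a flip without passing to
  forests.\<close>

definition tubing_inv :: "nat \<Rightarrow> nat set set \<Rightarrow> nat rel" where
  "tubing_inv n X = {(i, j). i \<in> {1..n} \<and> j \<in> {1..n} \<and> i < j \<and> j \<in> least_tube X i}"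

lemma image_prefix_permutes:
  fixes n :: nat
  assumes "w permutes {1..n}" "j \<in> {1..n}"
  shows "w ` {1..j} = {u \<in> {1..n}. inv w u \<le> inv w (w j)}"
proof (intro equalityI subsetI)
  fix u assume "u \<in> w ` {1..j}"
  then obtain i where "u = w i" "1 \<le> i" "i \<le> j" by auto
  moreover from this have "i \<in> {1..n}" using assms(2) by auto
  ultimately show "u \<in> {u \<in> {1..n}. inv w u \<le> inv w (w j)}"
    using permutes_in_image[OF assms(1), of i] by (simp add: permutes_inverses[OF assms(1)])
next
  fix u assume "u \<in> {u \<in> {1..n}. inv w u \<le> inv w (w j)}"
  then have "inv w u \<le> j" "u \<in> {1..n}" by (simp_all add: permutes_inverses[OF assms(1)])
  moreover have "1 \<le> inv w u" using permutes_in_seg[OF permutes_inv[OF assms(1)]] calculation by blast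
  ultimately show "u \<in> w ` {1..j}"
    by (intro image_eqI[of _ _ "inv w u"]) (simp_all add: permutes_inverses[OF assms(1)])
qed

lemma Psi_eq_prefix_components:
  assumes "w permutes {1..n}"
  shows "Psi n E w = prefix_component n E (inv w) ` {1..n}"
proof -
  have "Psi n E w = (\<lambda>j. prefix_component n E (inv w) (w j)) ` {1..n}"
    unfolding Psi_def prefix_component_def
    by (intro image_cong refl) (simp only: image_prefix_permutes[OF assms])
  also have "\<dots> = prefix_component n E (inv w) ` w ` {1..n}" by (simp only: image_image)
  finally show ?thesis by (simp only: permutes_image[OF assms])
qed

lemma perm_inv_eq_positions:
  assumes "w permutes {1..n}"
  shows "perm_inv n w = {(i, k). i \<in> {1..n} \<and> k \<in> {1..n} \<and> i < k \<and> inv w k < inv w i}"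
  (is "_ = ?R")
proof (intro equalityI subsetI; clarify)
  fix i k assume "(i, k) \<in> perm_inv n w"
  then obtain a b where "i < k" "a \<in> {1..n}" "b \<in> {1..n}" "a < b" "w a = k" "w b = i"
    by (auto simp: perm_inv_def)
  then show "i \<in> {1..n} \<and> k \<in> {1..n} \<and> i < k \<and> inv w k < inv w i"
    using permutes_inverses[OF assms] permutes_in_image[OF assms] by metis
next
  fix i k assume *: "i \<in> {1..n}" "k \<in> {1..n}" "i < k" "inv w k < inv w i"
  then have "inv w i \<in> {1..n}" "inv w k \<in> {1..n}"
    using permutes_in_image[OF permutes_inv[OF assms]] by blast+
  with * show "(i, k) \<in> perm_inv n w"
    unfolding perm_inv_def using permutes_inverses[OF assms] by blast
qed

lemma prefix_component_self: "v \<in> {1..n} \<Longrightarrow> v \<in> prefix_component n E q v"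
  by (simp add: prefix_component_def component_of_self)

lemma prefix_componentD:
  assumes "u \<in> prefix_component n E q v"
  shows "u \<in> {1..n}" "q u \<le> q v"
  using assms component_of_subset unfolding prefix_component_def by blast+

lemma tube_prefix_component:
  assumes sym: "sym E" and "v \<in> {1..n}"
  shows "tube n E (prefix_component n E q v)"
proof -
  have "connected_on E (prefix_component n E q v)"
    unfolding prefix_component_def using assms by (intro connected_on_component_of[OF sym]) simp
  then show ?thesis unfolding tube_def using prefix_componentD(1) by blast
qed

lemma connected_subset_prefix_component:
  assumes "connected_on E I" "v \<in> I" "I \<subseteq> {1..n}" "\<And>u. u \<in> I \<Longrightarrow> q u \<le> q v"
  shows "I \<subseteq> prefix_component n E q v"
  unfolding prefix_component_def using assms by (intro connected_subset_component_of) auto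

text \<open>\<open>m\<close> is the vertex of \<open>I\<close> listed last, so the prefix ending at
  \<open>m\<close> already contains \<open>I\<close>.\<close>

lemma connected_subset_last:
  assumes "connected_on E I" "I \<subseteq> {1..n}"
  obtains m where "m \<in> I" "I \<subseteq> prefix_component n E q m"
proof -
  have "finite I" "I \<noteq> {}" using assms finite_subset by (auto simp: connected_on_def)
  then have "Max (q ` I) \<in> q ` I" by (intro Max_in) auto
  then obtain m where "m \<in> I" "q m = Max (q ` I)" by auto
  moreover from this have "q u \<le> q m" if "u \<in> I" for u using that \<open>finite I\<close> by simp
  ultimately show ?thesis using that connected_subset_prefix_component assms by blast
qed

text \<open>A vertex of the component of \<open>k\<close> is listed no later than \<open>k\<close>,
  so its prefix is the smaller one. This makes each prefix component the least member of the family
  around its defining vertex.\<close>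

lemma prefix_component_least:
  assumes "v \<in> prefix_component n E q k" "k \<in> {1..n}"
  shows "prefix_component n E q v \<subseteq> prefix_component n E q k"
proof -
  have "{u \<in> {1..n}. q u \<le> q v} \<subseteq> {u \<in> {1..n}. q u \<le> q k}"
    using prefix_componentD[OF assms(1)] by auto
  then have "prefix_component n E q v \<subseteq> component_of E {u \<in> {1..n}. q u \<le> q k} v"
    unfolding prefix_component_def by (rule component_of_mono)
  also have "\<dots> \<subseteq> prefix_component n E q k"
    using assms unfolding prefix_component_def by (intro component_of_trans)
  finally show ?thesis .
qed

lemma least_tube_prefix_components:
  assumes "v \<in> {1..n}"
  shows "least_tube (prefix_component n E q ` {1..n}) v = prefix_component n E q v"
  unfolding least_tube_def using prefix_component_self assms prefix_component_least by blast

lemma inj_on_prefix_component: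
  assumes inj: "inj_on q {1..n}"
  shows "inj_on (prefix_component n E q) {1..n}"
proof (rule inj_onI)
  fix u v assume uv: "u \<in> {1..n}" "v \<in> {1..n}" "prefix_component n E q u = prefix_component n E q v"
  then have "q u \<le> q v" "q v \<le> q u" using prefix_component_self prefix_componentD by blast+
  then show "u = v" using inj uv by (auto dest: inj_onD)
qed

text \<open>Suppose the union of two components is connected. Its vertices are all listed by the
  later of the two defining vertices, so it lies in the component of that vertex, and the two
  components are nested.\<close>

lemma tubing_prefix_components:
  assumes sym: "sym E"
  shows "tubing n E (prefix_component n E q ` {1..n})"
proof -
  have *: "prefix_component n E q u \<subseteq> prefix_component n E q v"
    if "u \<in> {1..n}" "v \<in> {1..n}" "q u \<le> q v"
      "tube n E (prefix_component n E q u \<union> prefix_component n E q v)" for u v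
  proof -
    have "prefix_component n E q u \<union> prefix_component n E q v \<subseteq> prefix_component n E q v"
    proof (rule connected_subset_prefix_component)
      show "connected_on E (prefix_component n E q u \<union> prefix_component n E q v)"
        using that by (simp add: tube_def)
      fix x assume "x \<in> prefix_component n E q u \<union> prefix_component n E q v"
      then show "q x \<le> q v" using that(3) prefix_componentD(2) order_trans by blast
    qed (use that prefix_component_self prefix_componentD(1) in blast)+
    then show ?thesis by simp
  qed
  have "compatible n E (prefix_component n E q u) (prefix_component n E q v)"
    if "u \<in> {1..n}" "v \<in> {1..n}" for u v
    using *[of u v] *[of v u] that linear[of "q u" "q v"] unfolding compatible_def
    by (auto simp: Un_commute)
  then show ?thesis unfolding tubing_def using tube_prefix_component[OF sym] by blast
qed

text \<open>The position of \<open>v\<close> is one more than the number of its predecessors, and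
  the position function is the inverse of the word.\<close>

lemma strict_total_order_permutation:
  fixes n :: nat and R :: "nat rel"
  assumes irrefl: "\<And>u. u \<in> {1..n} \<Longrightarrow> (u, u) \<notin> R"
    and trans: "\<And>u v x. \<lbrakk>u \<in> {1..n}; v \<in> {1..n}; x \<in> {1..n}; (u, v) \<in> R; (v, x) \<in> R\<rbrakk> \<Longrightarrow> (u, x) \<in> R"
    and total: "\<And>u v. \<lbrakk>u \<in> {1..n}; v \<in> {1..n}; u \<noteq> v\<rbrakk> \<Longrightarrow> (u, v) \<in> R \<or> (v, u) \<in> R"
  shows "\<exists>w. w permutes {1..n} \<and>
    (\<forall>u\<in>{1..n}. \<forall>v\<in>{1..n}. inv w u < inv w v \<longleftrightarrow> (u, v) \<in> R)"
proof -
  define D where "D v = {u \<in> {1..n}. (u, v) \<in> R}" for v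
  \<comment> \<open>Values outside \<open>{1..n}\<close> are fixed because \<open>permutes\<close>
    demands it; \<open>Suc\<close> makes positions start at 1.\<close>
  define p where "p v = (if v \<in> {1..n} then Suc (card (D v)) else v)" for v
  have fin: "finite (D v)" for v by (simp add: D_def)
  have mono: "p u < p v" if uv: "u \<in> {1..n}" "v \<in> {1..n}" "(u, v) \<in> R" for u v
  proof -
    have "D u \<subset> D v"
    proof
      show "D u \<subseteq> D v" using trans uv unfolding D_def by blast
      show "D u \<noteq> D v" using irrefl uv unfolding D_def by blast
    qed
    then have "card (D u) < card (D v)" using fin by (rule psubset_card_mono[rotated])
    then show ?thesis using uv by (simp add: p_def)
  qed
  have inj: "inj_on p {1..n}"
  proof (rule inj_onI, rule ccontr)
    fix u v assume "u \<in> {1..n}" "v \<in> {1..n}" "p u = p v" "u \<noteq> v"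
    then show False using total mono by (metis less_irrefl)
  qed
  have "p ` {1..n} \<subseteq> {1..n}"
  proof
    fix y assume "y \<in> p ` {1..n}"
    then obtain v where v: "v \<in> {1..n}" "y = p v" by blast
    have "D v \<subset> {1..n}" using irrefl v unfolding D_def by blast
    then have "card (D v) < card {1..n}" by (intro psubset_card_mono) auto
    then show "y \<in> {1..n}" using v by (simp add: p_def)
  qed
  then have "bij_betw p {1..n} {1..n}"
    using inj by (simp add: bij_betw_def endo_inj_surj)
  then have p: "p permutes {1..n}" by (rule bij_imp_permutes) (unfold p_def, simp only: if_False)
  have iff: "p u < p v \<longleftrightarrow> (u, v) \<in> R" if "u \<in> {1..n}" "v \<in> {1..n}" for u v
    using that mono total by (metis less_irrefl less_asym')
  show ?thesis
    using permutes_inv[OF p] iff by (intro exI[of _ "inv p"]) (simp add: permutes_inv_inv[OF p])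
qed

text \<open>Otherwise the tubes of \<open>X\<close> properly inside \<open>C\<close> cover
  \<open>C\<close>. A maximal one, \<open>I\<close>, is left by an edge of \<open>C\<close> ending
  at some \<open>y\<close>, and \<open>y\<close> lies in another such tube \<open>J\<close>. The
  edge makes the union of \<open>I\<close> and \<open>J\<close> connected, so compatibility puts
  \<open>I\<close> properly inside \<open>J\<close>, against maximality.\<close>

lemma tubing_uncovered_vertex:
  assumes sym: "sym E" and X: "tubing n E X" and C: "connected_on E C" "C \<subseteq> {1..n}"
  shows "\<exists>v\<in>C. \<forall>I\<in>X. I \<subset> C \<longrightarrow> v \<notin> I"
proof (rule ccontr)
  assume "\<not> ?thesis"
  then have cov: "\<exists>I\<in>X. I \<subset> C \<and> v \<in> I" if "v \<in> C" for v using that by blast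
  define F where "F = {I \<in> X. I \<subset> C}"
  have "finite C" using C finite_subset by blast
  then have "finite (Pow C)" by simp
  then have "finite F" by (rule finite_subset[rotated]) (auto simp: F_def)
  moreover have "F \<noteq> {}" using cov C by (auto simp: F_def connected_on_def)
  ultimately obtain I where I: "I \<in> F" and max: "\<And>J. J \<in> F \<Longrightarrow> I \<subseteq> J \<Longrightarrow> I = J"
    using finite_has_maximal[of F] by metis
  then have IX: "I \<in> X" "I \<subset> C" by (auto simp: F_def)
  then have "connected_on E I" using X by (auto simp: tubing_def tube_def)
  then obtain u where "u \<in> I" by (auto simp: connected_on_def)
  with IX obtain v where "v \<in> C" "v \<notin> I" "u \<in> C" by blast
  then obtain x y where xy: "x \<in> I" "y \<in> C" "y \<notin> I" "(x, y) \<in> E"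
    using connected_on_crossing_edge[OF C(1) _ \<open>u \<in> I\<close>] by metis
  obtain J where J: "J \<in> X" "J \<subset> C" "y \<in> J" using cov xy by blast
  have "connected_on E J" using X J by (auto simp: tubing_def tube_def)
  then have "connected_on E (I \<union> J)"
    using connected_on_Un[OF sym \<open>connected_on E I\<close>] xy J by blast
  then have "tube n E (I \<union> J)" using IX J C by (auto simp: tube_def)
  moreover have "compatible n E I J" using X IX J by (auto simp: tubing_def)
  ultimately have "I \<subseteq> J" using xy J by (auto simp: compatible_def)
  then show False using max[of J] J xy by (auto simp: F_def)
qed

text \<open>The last vertex of \<open>S\<close> is chosen outside all tubes strictly inside its component.\<close>

lemma tubing_subset_prefix_components_aux:
  assumes sym: "sym E" and X: "tubing n E X" and "S \<subseteq> {1..n}"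
  shows "\<exists>q::nat \<Rightarrow> nat. inj_on q S \<and>
    (\<forall>I\<in>X. I \<subseteq> S \<longrightarrow> (\<exists>v\<in>S. I = component_of E {u \<in> S. q u \<le> q v} v))"
  using assms(3)
proof (induction "card S" arbitrary: S)
  case 0
  then have "S = {}" using finite_subset by fastforce
  moreover have "I \<noteq> {}" if "I \<in> X" for I
    using X that by (auto simp: tubing_def tube_def connected_on_def)
  ultimately show ?case by auto
next
  case (Suc m)
  have fin: "finite S" using Suc finite_subset by blast
  obtain s where s: "s \<in> S" using Suc by fastforce
  let ?C = "component_of E S s"
  have conn: "connected_on E ?C" using connected_on_component_of[OF sym s] .
  have "?C \<subseteq> {1..n}" using component_of_subset Suc.prems by blast
  then obtain v where v: "v \<in> ?C" and unc: "\<And>I. \<lbrakk>I \<in> X; I \<subset> ?C\<rbrakk> \<Longrightarrow> v \<notin> I"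
    using tubing_uncovered_vertex[OF sym X conn] by blast
  have Cv: "component_of E S v = ?C" using component_of_sym[OF sym v] .
  have vS: "v \<in> S" using v component_of_subset by blast
  have "m = card (S - {v})" using Suc(2) vS by simp
  moreover have "S - {v} \<subseteq> {1..n}" using Suc.prems by blast
  ultimately obtain q :: "nat \<Rightarrow> nat" where q: "inj_on q (S - {v})" and
    qI: "\<forall>I\<in>X. I \<subseteq> S - {v} \<longrightarrow> (\<exists>x\<in>S - {v}. I = component_of E {u \<in> S - {v}. q u \<le> q x} x)"
    by (rule Suc.hyps(1)[THEN exE]) (elim conjE)
  \<comment> \<open>\<open>M\<close> lies above every value of \<open>q\<close> on the remaining
    vertices; the inserted 0 keeps \<open>Max\<close> meaningful when
    \<open>S = {v}\<close>.\<close>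
  define M where "M = Suc (Max (insert 0 (q ` (S - {v}))))"
  define q' where "q' = q(v := M)"
  have less: "q u < M" if "u \<in> S - {v}" for u
    using that fin unfolding M_def by (simp add: le_imp_less_Suc)
  have "inj_on q' S"
  proof (rule inj_onI)
    fix a b assume "a \<in> S" "b \<in> S" "q' a = q' b"
    then show "a = b" using less[of a] less[of b] inj_onD[OF q, of a b]
      by (auto simp: q'_def split: if_splits)
  qed
  moreover have "\<exists>x\<in>S. I = component_of E {u \<in> S. q' u \<le> q' x} x" if I: "I \<in> X" "I \<subseteq> S" for I
  proof (cases "v \<in> I")
    case True
    have "connected_on E I" using X I by (auto simp: tubing_def tube_def)
    then have "I \<subseteq> ?C" using connected_subset_component_of[of E I v S] True I Cv by simp
    \<comment> \<open>By the choice of \<open>v\<close>, a tube through \<open>v\<close> inside the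
      component cannot be proper.\<close>
    then have "I = ?C" using unc[OF I(1)] True by blast
    moreover have "{u \<in> S. q' u \<le> q' v} = S" using less by (force simp: q'_def)
    ultimately show ?thesis using vS Cv by metis
  next
    case False
    then obtain x where x: "x \<in> S - {v}" "I = component_of E {u \<in> S - {v}. q u \<le> q x} x"
      using bspec[OF qI I(1)] I(2) by blast
    moreover have "{u \<in> S. q' u \<le> q' x} = {u \<in> S - {v}. q u \<le> q x}"
      using x(1) less[of x] by (auto simp: q'_def)
    ultimately have "I = component_of E {u \<in> S. q' u \<le> q' x} x" by simp
    then show ?thesis using x(1) by (intro bexI[of _ x]) auto
  qed
  ultimately show ?case by blast
qed

lemma tubing_subset_prefix_components:
  assumes "sym E" "tubing n E X"
  obtains q where "inj_on q {1..n}" "X \<subseteq> prefix_component n E q ` {1..n}"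
proof -
  obtain q :: "nat \<Rightarrow> nat" where "inj_on q {1..n}" and
    q: "\<forall>I\<in>X. I \<subseteq> {1..n} \<longrightarrow> (\<exists>v\<in>{1..n}. I = component_of E {u \<in> {1..n}. q u \<le> q v} v)"
    using tubing_subset_prefix_components_aux[OF assms subset_refl] by blast
  moreover have "X \<subseteq> prefix_component n E q ` {1..n}"
  proof
    fix I assume "I \<in> X"
    then have "I \<subseteq> {1..n}" using assms(2) by (auto simp: tubing_def tube_def)
    then show "I \<in> prefix_component n E q ` {1..n}"
      using q \<open>I \<in> X\<close> unfolding prefix_component_def by blast
  qed
  ultimately show ?thesis using that by blast
qed

text \<open>Any tubing \<open>Y\<close> extending \<open>X\<close> sits in a family of exactly
  \<open>n\<close> prefix components; having \<open>n\<close> members, \<open>X\<close> already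
  fills that family.\<close>

lemma maximal_tubingI_card:
  assumes "sym E" "tubing n E X" "card X = n"
  shows "maximal_tubing n E X"
  unfolding maximal_tubing_def
proof (intro conjI allI impI)
  fix Y assume Y: "tubing n E Y \<and> X \<subseteq> Y"
  then obtain q where q: "inj_on q {1..n}" "Y \<subseteq> prefix_component n E q ` {1..n}"
    using tubing_subset_prefix_components assms(1) by metis
  have "card (prefix_component n E q ` {1..n}) = n"
    using card_image[OF inj_on_prefix_component[OF q(1)]] by simp
  then have "X = prefix_component n E q ` {1..n}"
    using assms(3) q(2) Y by (intro card_subset_eq) auto
  then show "Y = X" using q(2) Y by blast
qed (rule assms(2))

lemma maximal_tubing_prefix_components:
  assumes "sym E" "inj_on q {1..n}"
  shows "maximal_tubing n E (prefix_component n E q ` {1..n})"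
  using assms card_image[OF inj_on_prefix_component[OF assms(2)]]
  by (intro maximal_tubingI_card tubing_prefix_components) simp_all

lemma maximal_tubing_Psi:
  assumes "sym E" "w permutes {1..n}"
  shows "maximal_tubing n E (Psi n E w)"
  using maximal_tubing_prefix_components[OF assms(1) permutes_inj_on[OF permutes_inv[OF assms(2)]]]
    Psi_eq_prefix_components[OF assms(2)] by simp

lemma maximal_tubing_cases:
  assumes "sym E" "maximal_tubing n E X"
  obtains q where "inj_on q {1..n}" "X = prefix_component n E q ` {1..n}"
    "\<And>v. v \<in> {1..n} \<Longrightarrow> least_tube X v = prefix_component n E q v"
proof -
  have "tubing n E X" using assms(2) by (simp add: maximal_tubing_def)
  then obtain q where q: "inj_on q {1..n}" "X \<subseteq> prefix_component n E q ` {1..n}"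
    using tubing_subset_prefix_components assms(1) by metis
  then have "X = prefix_component n E q ` {1..n}"
    using assms tubing_prefix_components unfolding maximal_tubing_def by metis
  then show ?thesis using that q(1) least_tube_prefix_components assms(1) by metis
qed

section \<open>Least tubes as the forest order on the vertices\<close>

lemma least_tube_self: "v \<in> least_tube X v"
  by (simp add: least_tube_def)

lemma least_tube_subset: "I \<in> X \<Longrightarrow> v \<in> I \<Longrightarrow> least_tube X v \<subseteq> I"
  by (auto simp: least_tube_def)

context
  fixes n :: nat and E :: "nat rel" and X :: "nat set set"
  assumes sym: "sym E" and X: "maximal_tubing n E X"
begin

lemma maximal_tubing_eq: "X = least_tube X ` {1..n}"
proof -
  obtain q where q: "X = prefix_component n E q ` {1..n}"
    "\<And>v. v \<in> {1..n} \<Longrightarrow> least_tube X v = prefix_component n E q v"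
    using maximal_tubing_cases[OF sym X] by metis
  have "least_tube X ` {1..n} = prefix_component n E q ` {1..n}" by (intro image_cong q refl)
  then show ?thesis using q(1) by simp
qed

lemma least_tube_in: "v \<in> {1..n} \<Longrightarrow> least_tube X v \<in> X"
  using maximal_tubing_eq by blast

lemma least_tube_mono: "\<lbrakk>u \<in> least_tube X v; v \<in> {1..n}\<rbrakk> \<Longrightarrow> least_tube X u \<subseteq> least_tube X v"
  using least_tube_subset least_tube_in by blast

lemma tube_least_tube: "v \<in> {1..n} \<Longrightarrow> tube n E (least_tube X v)"
  using least_tube_in X by (auto simp: maximal_tubing_def tubing_def)

lemma least_tube_bounds: "\<lbrakk>u \<in> least_tube X v; v \<in> {1..n}\<rbrakk> \<Longrightarrow> u \<in> {1..n}"
  using tube_least_tube unfolding tube_def by blast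

lemma inj_on_least_tube: "inj_on (least_tube X) {1..n}"
proof -
  obtain q where q: "inj_on q {1..n}"
    "\<And>v. v \<in> {1..n} \<Longrightarrow> least_tube X v = prefix_component n E q v"
    using maximal_tubing_cases[OF sym X] by metis
  show ?thesis using inj_on_cong[of "{1..n}" "least_tube X" "prefix_component n E q"] q(2)
      inj_on_prefix_component[OF q(1)] by blast
qed

lemma least_tube_antisym:
  assumes "u \<in> least_tube X v" "v \<in> least_tube X u" "u \<in> {1..n}" "v \<in> {1..n}"
  shows "u = v"
  using least_tube_mono assms inj_onD[OF inj_on_least_tube] by blast

text \<open>The vertex of \<open>I\<close> listed last by an underlying \<open>q\<close> works. This
  is how maximality gets used later: a tube enlarged along an edge still lies in the tube of one of
  its own vertices.\<close>

lemma connected_subset_least_tube: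
  assumes "connected_on E I" "I \<subseteq> {1..n}"
  obtains m where "m \<in> I" "I \<subseteq> least_tube X m"
proof -
  obtain q where q: "\<And>v. v \<in> {1..n} \<Longrightarrow> least_tube X v = prefix_component n E q v"
    using maximal_tubing_cases[OF sym X] by metis
  obtain m where "m \<in> I" "I \<subseteq> prefix_component n E q m"
    using connected_subset_last[OF assms, of q] by blast
  moreover have "m \<in> {1..n}" using \<open>m \<in> I\<close> assms(2) by blast
  ultimately show ?thesis using that q by simp
qed

text \<open>Another uncovered \<open>u\<close> would have its least tube inside that of
  \<open>v\<close>, and not properly so; but equal least tubes belong to the same vertex.\<close>

lemma tube_top_least_tube:
  assumes "v \<in> {1..n}"
  shows "tube_top X (least_tube X v) = v"
  unfolding tube_top_def
proof (rule the_equality)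
  show "v \<in> least_tube X v \<and> (\<forall>J\<in>X. J \<subset> least_tube X v \<longrightarrow> v \<notin> J)"
    using least_tube_self least_tube_subset by blast
next
  fix u assume u: "u \<in> least_tube X v \<and> (\<forall>J\<in>X. J \<subset> least_tube X v \<longrightarrow> u \<notin> J)"
  then have "u \<in> {1..n}" using least_tube_bounds assms by blast
  then have "\<not> least_tube X u \<subset> least_tube X v" using u least_tube_in least_tube_self by blast
  then have "least_tube X u = least_tube X v" using least_tube_mono u assms by blast
  then show "u = v" using inj_onD[OF inj_on_least_tube] \<open>u \<in> {1..n}\<close> assms by blast
qed

lemma trans_tubing_inv: "trans (tubing_inv n X)"
  using least_tube_mono by (intro transI) (fastforce simp: tubing_inv_def)

text \<open>If \<open>j\<close> is missing from the tube of \<open>i\<close>, it is adjacent to it,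
  so adding \<open>j\<close> keeps the set connected and the result lies in the tube of one of its
  vertices \<open>m\<close>. A vertex \<open>m\<close> of the tube of \<open>i\<close> is
  impossible, since its tube stays inside that of \<open>i\<close> and misses \<open>j\<close>;
  hence \<open>m = j\<close>, and \<open>k\<close> lies in the tube of \<open>j\<close>.\<close>

lemma tubing_inv_cotrans:
  assumes rf: "right_filled E" and ik: "(i, k) \<in> tubing_inv n X" and j: "i < j" "j < k"
  shows "(i, j) \<in> tubing_inv n X \<or> (j, k) \<in> tubing_inv n X"
proof -
  from ik have *: "i \<in> {1..n}" "k \<in> {1..n}" "k \<in> least_tube X i" by (auto simp: tubing_inv_def)
  have jn: "j \<in> {1..n}" using * j by auto
  have conn: "connected_on E (least_tube X i)" using tube_least_tube[OF *(1)] by (simp add: tube_def)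
  have "j \<in> least_tube X i \<or> k \<in> least_tube X j"
  proof (rule disjCI)
    assume nk: "k \<notin> least_tube X j"
    show "j \<in> least_tube X i"
    proof (rule ccontr)
      assume nj: "j \<notin> least_tube X i"
      then obtain v where v: "v \<in> least_tube X i" "(j, v) \<in> E"
        using right_filled_adjacent[OF rf conn least_tube_self *(3) j] by metis
      have "connected_on E ({j} \<union> least_tube X i)"
        using connected_on_Un[OF sym connected_on_singleton conn] v by blast
      moreover have "{j} \<union> least_tube X i \<subseteq> {1..n}" using jn least_tube_bounds * by blast
      ultimately obtain m where m: "m \<in> {j} \<union> least_tube X i" "{j} \<union> least_tube X i \<subseteq> least_tube X m"
        using connected_subset_least_tube by metis
      then have "m \<noteq> j" using nk *(3) by blast
      then have "least_tube X m \<subseteq> least_tube X i" using m least_tube_mono *(1) by blast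
      then show False using m nj by blast
    qed
  qed
  then show ?thesis using * jn j by (auto simp: tubing_inv_def)
qed

text \<open>The component at \<open>i\<close> contains the tube of \<open>i\<close>, all of which is
  listed by then, and is contained in the tube of one of its own vertices \<open>m\<close>. As a
  vertex of that component \<open>m\<close> comes no later than \<open>i\<close>, and as the top of
  a tube containing \<open>i\<close> no earlier; so \<open>m = i\<close>.\<close>

lemma linear_extension_prefix_components:
  assumes q: "inj_on q {1..n}"
    and ext: "\<And>i j. \<lbrakk>i \<in> {1..n}; j \<in> least_tube X i\<rbrakk> \<Longrightarrow> q j \<le> q i"
  shows "prefix_component n E q ` {1..n} = X"
proof -
  have "prefix_component n E q i = least_tube X i" if i: "i \<in> {1..n}" for i
  proof
    show "least_tube X i \<subseteq> prefix_component n E q i"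
      using i tube_least_tube[OF i] least_tube_self ext
      by (intro connected_subset_prefix_component) (auto simp: tube_def)
    have "tube n E (prefix_component n E q i)" using tube_prefix_component[OF sym i] .
    then obtain m where m: "m \<in> prefix_component n E q i" "prefix_component n E q i \<subseteq> least_tube X m"
      using connected_subset_least_tube unfolding tube_def by metis
    have m': "m \<in> {1..n}" "q m \<le> q i" using m(1) by (rule prefix_componentD)+
    have "i \<in> least_tube X m" using m prefix_component_self[OF i] by blast
    then have "q i \<le> q m" using ext m' by blast
    then have "m = i" using q m' i by (auto dest: inj_onD)
    then show "prefix_component n E q i \<subseteq> least_tube X i" using m by simp
  qed
  then have "prefix_component n E q ` {1..n} = least_tube X ` {1..n}" by (intro image_cong refl)
  then show ?thesis using maximal_tubing_eq by simp
qed

end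

section \<open>Inversion sets\<close>

text \<open>The classical description of inversion sets: \<open>S\<close> and its complement among
  the pairs \<open>i < k\<close> are both transitive, the latter written in contrapositive
  form.\<close>

definition biclosed :: "nat \<Rightarrow> nat rel \<Rightarrow> bool" where
  "biclosed n S \<longleftrightarrow> S \<subseteq> {(i, k). i \<in> {1..n} \<and> k \<in> {1..n} \<and> i < k} \<and> trans S \<and>
     (\<forall>i j k. (i, k) \<in> S \<and> i < j \<and> j < k \<longrightarrow> (i, j) \<in> S \<or> (j, k) \<in> S)"

lemma biclosed_bounds: "\<lbrakk>biclosed n S; (i, k) \<in> S\<rbrakk> \<Longrightarrow> i \<in> {1..n} \<and> k \<in> {1..n} \<and> i < k"
  unfolding biclosed_def by blast

lemma biclosed_perm_inv:
  assumes "w permutes {1..n}"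
  shows "biclosed n (perm_inv n w)"
  unfolding biclosed_def perm_inv_eq_positions[OF assms] trans_def by auto

lemma biclosed_tubing_inv:
  assumes "sym E" "right_filled E" "maximal_tubing n E X"
  shows "biclosed n (tubing_inv n X)"
  unfolding biclosed_def
proof (intro conjI)
  show "tubing_inv n X \<subseteq> {(i, k). i \<in> {1..n} \<and> k \<in> {1..n} \<and> i < k}"
    unfolding tubing_inv_def by blast
qed (use assms trans_tubing_inv tubing_inv_cotrans in blast)+

text \<open>\<open>S\<close> dictates a listing: \<open>(u, v) \<in> R\<close> says that
  \<open>u\<close> precedes \<open>v\<close>, in natural order except for the pairs of
  \<open>S\<close>. Transitivity of \<open>S\<close> and of its complement combine to transitivity
  of \<open>R\<close>.\<close>

lemma biclosed_imp_perm_inv: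
  assumes "biclosed n S"
  obtains w where "w permutes {1..n}" "perm_inv n w = S"
proof -
  define R where "R = {(u, v). u < v \<and> (u, v) \<notin> S \<or> v < u \<and> (v, u) \<in> S}"
  have tr: "(i, j) \<in> S \<Longrightarrow> (j, k) \<in> S \<Longrightarrow> (i, k) \<in> S" for i j k
    using assms unfolding biclosed_def by (meson transD)
  have co: "(i, k) \<in> S \<Longrightarrow> i < j \<Longrightarrow> j < k \<Longrightarrow> (i, j) \<in> S \<or> (j, k) \<in> S" for i j k
    using assms unfolding biclosed_def by blast
  have trans: "(u, x) \<in> R" if uvx: "(u, v) \<in> R" "(v, x) \<in> R" for u v x
  proof -
    consider "u < v" "(u, v) \<notin> S" "v < x" "(v, x) \<notin> S"
      | "u < v" "(u, v) \<notin> S" "x < v" "(x, v) \<in> S"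
      | "v < u" "(v, u) \<in> S" "v < x" "(v, x) \<notin> S"
      | "v < u" "(v, u) \<in> S" "x < v" "(x, v) \<in> S"
      using uvx unfolding R_def by blast
    then show ?thesis
    proof cases
      case 1
      then show ?thesis using co[of u x v] by (auto simp: R_def)
    next
      case 2
      then show ?thesis using co[of x v u] tr[of u x v]
        by (cases u x rule: linorder_cases) (auto simp: R_def)
    next
      case 3
      then show ?thesis using co[of v u x] tr[of v u x]
        by (cases u x rule: linorder_cases) (auto simp: R_def)
    next
      case 4
      then show ?thesis using tr[of x v u] by (auto simp: R_def)
    qed
  qed
  have "\<exists>w. w permutes {1..n} \<and> (\<forall>u\<in>{1..n}. \<forall>v\<in>{1..n}. inv w u < inv w v \<longleftrightarrow> (u, v) \<in> R)"
  proof (rule strict_total_order_permutation)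
    show "(u, u) \<notin> R" for u by (simp add: R_def)
    show "(u, v) \<in> R \<or> (v, u) \<in> R" if "u \<noteq> v" for u v using that by (auto simp: R_def)
  qed (rule trans)
  then obtain w where w: "w permutes {1..n}"
    "\<And>u v. \<lbrakk>u \<in> {1..n}; v \<in> {1..n}\<rbrakk> \<Longrightarrow> inv w u < inv w v \<longleftrightarrow> (u, v) \<in> R" by blast
  have "perm_inv n w = {(i, k). i \<in> {1..n} \<and> k \<in> {1..n} \<and> i < k \<and> (k, i) \<in> R}"
    unfolding perm_inv_eq_positions[OF w(1)] using w(2) by blast
  also have "\<dots> = S" using biclosed_bounds[OF assms] by (auto simp: R_def)
  finally show ?thesis using that w(1) by blast
qed

text \<open>The hypothesis makes \<open>inv v \<circ> u\<close> increasing on \<open>{1..n}\<close>,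
  so it is bounded below by the identity and therefore equal to it. Contrapositively, distinct
  permutations are told apart at two adjacent letters of \<open>u\<close>; this serves both the
  injectivity of \<open>perm_inv\<close> and the choice of the next transposition in a
  chain.\<close>

lemma permutes_eq_if_ascents:
  fixes u v :: "nat \<Rightarrow> nat"
  assumes u: "u permutes {1..n}" and v: "v permutes {1..n}"
    and asc: "\<And>i. \<lbrakk>1 \<le> i; i < n\<rbrakk> \<Longrightarrow> inv v (u i) < inv v (u (Suc i))"
  shows "u = v"
proof -
  let ?f = "inv v \<circ> u"
  have f: "?f permutes {1..n}" using permutes_compose[OF u permutes_inv[OF v]] .
  have "1 \<le> i \<Longrightarrow> i \<le> n \<Longrightarrow> i \<le> ?f i" for i
  proof (induction i)
    case (Suc i)
    show ?case
    proof (cases "i = 0")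
      case True
      then show ?thesis using Suc permutes_in_seg[OF f, of 1] by simp
    next
      case False
      then show ?thesis using Suc asc[of i] by simp
    qed
  qed simp
  then have "?f = id" using permutes_natset_ge[OF f] by simp
  then have "v \<circ> ?f = v" by simp
  then show ?thesis using permutes_inverses(1)[OF v] by (simp add: fun_eq_iff)
qed

lemma perm_inv_inject:
  assumes u: "u permutes {1..n}" and v: "v permutes {1..n}" and eq: "perm_inv n u = perm_inv n v"
  shows "u = v"
proof (rule permutes_eq_if_ascents[OF u v])
  fix i assume i: "1 \<le> i" "i < n"
  have b: "u i \<in> {1..n}" "u (Suc i) \<in> {1..n}" using i permutes_in_image[OF u] by auto
  have pos: "inv u (u i) = i" "inv u (u (Suc i)) = Suc i" using permutes_inverses(2)[OF u] by blast+
  have ne: "u i \<noteq> u (Suc i)" by (simp add: inj_eq[OF permutes_inj[OF u]])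
  then have ne': "inv v (u i) \<noteq> inv v (u (Suc i))"
    by (simp add: inj_eq[OF permutes_inj[OF permutes_inv[OF v]]])
  show "inv v (u i) < inv v (u (Suc i))"
  proof (cases "u i < u (Suc i)")
    case True
    then have "(u i, u (Suc i)) \<notin> perm_inv n u" by (simp add: perm_inv_eq_positions[OF u] pos)
    then have "\<not> inv v (u (Suc i)) < inv v (u i)"
      using eq b True by (simp add: perm_inv_eq_positions[OF v])
    then show ?thesis using ne' by simp
  next
    case False
    then have "(u (Suc i), u i) \<in> perm_inv n u"
      using b ne by (simp add: perm_inv_eq_positions[OF u] pos)
    then show ?thesis using eq by (simp add: perm_inv_eq_positions[OF v])
  qed
qed

text \<open>Every third letter stands before both or after both of the exchanged letters, so the
  exchanged pair is the only one whose order changes.\<close>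

lemma perm_inv_adjacent_transposition:
  fixes w :: "nat \<Rightarrow> nat"
  assumes w: "w permutes {1..n}" and i: "1 \<le> i" "i < n" "w i < w (Suc i)"
  defines "w' \<equiv> w \<circ> transpose i (Suc i)"
  shows "w' permutes {1..n}"
    and "inv w' u = (if u = w i then Suc i else if u = w (Suc i) then i else inv w u)"
    and "perm_inv n w' = insert (w i, w (Suc i)) (perm_inv n w)"
proof -
  have t: "transpose i (Suc i) permutes {1..n}" using i by (intro permutes_swap_id) auto
  show w': "w' permutes {1..n}" unfolding w'_def by (rule permutes_compose[OF t w])
  have inj: "w x = w y \<longleftrightarrow> x = y" for x y by (rule inj_eq[OF permutes_inj[OF w]])
  have ne: "inv w u = x \<longleftrightarrow> u = w x" for u x using permutes_inverses[OF w] by metis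
  show pos: "inv w' u = (if u = w i then Suc i else if u = w (Suc i) then i else inv w u)" for u
  proof -
    have "w' (if u = w i then Suc i else if u = w (Suc i) then i else inv w u) = u"
      using permutes_inverses(1)[OF w, of u] by (auto simp: w'_def transpose_def ne)
    then show ?thesis using permutes_inv_eq[OF w'] by blast
  qed
  have "i \<in> {1..n}" "Suc i \<in> {1..n}" using i(1,2) by auto
  then have b: "w i \<in> {1..n}" "w (Suc i) \<in> {1..n}" by (simp_all only: permutes_in_image[OF w])
  have wi: "inv w (w x) = x" for x by (rule permutes_inverses(2)[OF w])
  have *: "inv w' k < inv w' j \<longleftrightarrow> (j = w i \<and> k = w (Suc i)) \<or> inv w k < inv w j" if "j < k" for j k
  proof -
    \<comment> \<open>The combination \<open>j = w (Suc i)\<close>, \<open>k = w i\<close> is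
      excluded by \<open>j < k\<close> and \<open>w i < w (Suc i)\<close>.\<close>
    consider "j = w i" "k = w (Suc i)" | "j = w i" "k \<noteq> w (Suc i)" "k \<noteq> w i"
      | "j = w (Suc i)" "k \<noteq> w i" "k \<noteq> w (Suc i)"
      | "j \<noteq> w i" "j \<noteq> w (Suc i)" "k = w i" | "j \<noteq> w i" "j \<noteq> w (Suc i)" "k = w (Suc i)"
      | "j \<noteq> w i" "j \<noteq> w (Suc i)" "k \<noteq> w i" "k \<noteq> w (Suc i)"
      using \<open>j < k\<close> i by force
    then show ?thesis
      using i ne[of j i] ne[of j "Suc i"] ne[of k i] ne[of k "Suc i"]
      by cases (auto simp: pos wi)
  qed
  show "perm_inv n w' = insert (w i, w (Suc i)) (perm_inv n w)"
    unfolding perm_inv_eq_positions[OF w] perm_inv_eq_positions[OF w'] using * b i by auto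
qed

section \<open>Joins and meets of the weak order through inversion sets\<close>

lemma biclosed_trancl_Un:
  assumes "biclosed n A" "biclosed n B"
  shows "biclosed n ((A \<union> B)\<^sup>+)"
  unfolding biclosed_def
proof (intro conjI allI impI)
  have bd: "i \<in> {1..n} \<and> k \<in> {1..n} \<and> i < k" if "(i, k) \<in> (A \<union> B)\<^sup>+" for i k
    using that by (induction rule: trancl_induct)
      (use biclosed_bounds[OF assms(1)] biclosed_bounds[OF assms(2)] in \<open>auto intro: less_trans\<close>)
  then show "(A \<union> B)\<^sup>+ \<subseteq> {(i, k). i \<in> {1..n} \<and> k \<in> {1..n} \<and> i < k}" by blast
  have co: "(i, j) \<in> A \<union> B \<or> (j, k) \<in> A \<union> B" if "(i, k) \<in> A \<union> B" "i < j" "j < k" for i j k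
    using that assms unfolding biclosed_def by blast
  fix i j k assume *: "(i, k) \<in> (A \<union> B)\<^sup>+ \<and> i < j \<and> j < k"
  then have "(i, k) \<in> (A \<union> B)\<^sup>+" by blast
  then have "i < j \<longrightarrow> j < k \<longrightarrow> (i, j) \<in> (A \<union> B)\<^sup>+ \<or> (j, k) \<in> (A \<union> B)\<^sup>+"
  proof (induction rule: trancl_induct)
    case (base k)
    then show ?case using co by blast
  next
    case (step k l)
    \<comment> \<open>\<open>k\<close> is the start of the last link of the chain: \<open>j\<close>
      falls into the earlier part, on \<open>k\<close> itself, or beyond \<open>k\<close>. In the
      last case, if it lies inside the link, \<open>A\<close> or \<open>B\<close> splits the link
      there.\<close>
    consider "j < k" | "j = k" | "k < j" by linarith
    then show ?case
    proof cases
      case 1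
      then show ?thesis using step by (meson trancl_into_trancl)
    next
      case 2
      then show ?thesis using step by simp
    next
      case 3
      then show ?thesis using step co[of k l j] by (meson r_into_trancl trancl_into_trancl)
    qed
  qed
  then show "(i, j) \<in> (A \<union> B)\<^sup>+ \<or> (j, k) \<in> (A \<union> B)\<^sup>+" using * by blast
qed (rule trans_trancl)

text \<open>Transitivity and its dual exchange roles. This supplies the order-reversing involution
  that turns joins into meets.\<close>

lemma biclosed_complement:
  assumes "biclosed n S"
  shows "biclosed n ({(i, k). i \<in> {1..n} \<and> k \<in> {1..n} \<and> i < k} - S)"
  unfolding biclosed_def
proof (intro conjI allI impI)
  show "trans ({(i, k). i \<in> {1..n} \<and> k \<in> {1..n} \<and> i < k} - S)"
    using assms unfolding biclosed_def trans_def by (simp, meson less_trans)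
  fix i j k assume "(i, k) \<in> {(i, k). i \<in> {1..n} \<and> k \<in> {1..n} \<and> i < k} - S \<and> i < j \<and> j < k"
  moreover from this have "\<not> ((i, j) \<in> S \<and> (j, k) \<in> S)"
    using assms unfolding biclosed_def trans_def by blast
  ultimately show "(i, j) \<in> {(i, k). i \<in> {1..n} \<and> k \<in> {1..n} \<and> i < k} - S \<or>
    (j, k) \<in> {(i, k). i \<in> {1..n} \<and> k \<in> {1..n} \<and> i < k} - S" by auto
qed blast

text \<open>Inversion sets are transitive, so one that contains both given sets contains the
  transitive closure of their union; by \<open>biclosed_trancl_Un\<close> this closure is an
  inversion set itself.\<close>

lemma weak_order_join:
  assumes "x permutes {1..n}" "y permutes {1..n}"
  obtains s where "s permutes {1..n}"
    "\<forall>z. z permutes {1..n} \<longrightarrow>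
      (perm_inv n s \<subseteq> perm_inv n z \<longleftrightarrow> perm_inv n x \<union> perm_inv n y \<subseteq> perm_inv n z)"
proof -
  let ?J = "(perm_inv n x \<union> perm_inv n y)\<^sup>+"
  have "biclosed n ?J" using assms by (intro biclosed_trancl_Un biclosed_perm_inv)
  then obtain s where s: "s permutes {1..n}" "perm_inv n s = ?J"
    by (rule biclosed_imp_perm_inv)
  have "?J \<subseteq> perm_inv n z \<longleftrightarrow> perm_inv n x \<union> perm_inv n y \<subseteq> perm_inv n z" if "z permutes {1..n}" for z
  proof
    assume "perm_inv n x \<union> perm_inv n y \<subseteq> perm_inv n z"
    then have "?J \<subseteq> (perm_inv n z)\<^sup>+" by (rule trancl_mono_subset)
    also have "\<dots> = perm_inv n z"
      using biclosed_perm_inv[OF that] by (simp add: biclosed_def)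
    finally show "?J \<subseteq> perm_inv n z" .
  qed (auto intro: r_into_trancl')
  then show ?thesis using that s by simp
qed

text \<open>Complementing inversion sets reverses the order, so the meet is the complement of the
  join of the complements.\<close>

lemma weak_order_meet:
  assumes "x permutes {1..n}" "y permutes {1..n}"
  obtains m where "m permutes {1..n}"
    "\<forall>z. z permutes {1..n} \<longrightarrow>
      (perm_inv n z \<subseteq> perm_inv n m \<longleftrightarrow> perm_inv n z \<subseteq> perm_inv n x \<inter> perm_inv n y)"
proof -
  define P where "P = {(i, k). i \<in> {1..n} \<and> k \<in> {1..n} \<and> i < k}"
  have rev: "\<exists>w'. w' permutes {1..n} \<and> perm_inv n w' = P - perm_inv n w" if "w permutes {1..n}" for w
    using biclosed_imp_perm_inv[OF biclosed_complement[OF biclosed_perm_inv[OF that]]]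
    unfolding P_def by blast
  have sub: "perm_inv n w \<subseteq> P" if "w permutes {1..n}" for w
    using biclosed_perm_inv[OF that] by (simp add: biclosed_def P_def)
  obtain x' where x': "x' permutes {1..n}" "perm_inv n x' = P - perm_inv n x"
    using rev[OF assms(1)] by blast
  obtain y' where y': "y' permutes {1..n}" "perm_inv n y' = P - perm_inv n y"
    using rev[OF assms(2)] by blast
  obtain s where s: "s permutes {1..n}" "\<forall>z. z permutes {1..n} \<longrightarrow>
      (perm_inv n s \<subseteq> perm_inv n z \<longleftrightarrow> perm_inv n x' \<union> perm_inv n y' \<subseteq> perm_inv n z)"
    by (rule weak_order_join[OF x'(1) y'(1)])
  obtain m where m: "m permutes {1..n}" "perm_inv n m = P - perm_inv n s" using rev[OF s(1)] by blast
  have "perm_inv n z \<subseteq> perm_inv n m \<longleftrightarrow> perm_inv n z \<subseteq> perm_inv n x \<inter> perm_inv n y"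
    if z: "z permutes {1..n}" for z
  proof -
    obtain z' where z': "z' permutes {1..n}" "perm_inv n z' = P - perm_inv n z" using rev[OF z] by blast
    have "perm_inv n s \<subseteq> P - perm_inv n z \<longleftrightarrow>
        (P - perm_inv n x) \<union> (P - perm_inv n y) \<subseteq> P - perm_inv n z"
      using s(2) z' x'(2) y'(2) by metis
    then show ?thesis using m(2) sub[OF z] sub[OF s(1)] by blast
  qed
  then show ?thesis using that m(1) by simp
qed

section \<open>Permutations and maximal tubings\<close>

context
  fixes n :: nat and E :: "nat rel" and w :: "nat \<Rightarrow> nat"
  assumes sym: "sym E" and w: "w permutes {1..n}"
begin

lemma least_tube_Psi:
  "v \<in> {1..n} \<Longrightarrow> least_tube (Psi n E w) v = prefix_component n E (inv w) v"
  unfolding Psi_eq_prefix_components[OF w] by (rule least_tube_prefix_components)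

lemma tubing_inv_Psi:
  "tubing_inv n (Psi n E w) =
    {(i, j). i \<in> {1..n} \<and> j \<in> {1..n} \<and> i < j \<and> j \<in> prefix_component n E (inv w) i}"
  unfolding tubing_inv_def using least_tube_Psi by blast

lemma tubing_inv_Psi_subset: "tubing_inv n (Psi n E w) \<subseteq> perm_inv n w"
proof clarify
  fix i j assume "(i, j) \<in> tubing_inv n (Psi n E w)"
  then have *: "i \<in> {1..n}" "j \<in> {1..n}" "i < j" "inv w j \<le> inv w i"
    unfolding tubing_inv_Psi using prefix_componentD(2) by blast+
  moreover have "inv w j \<noteq> inv w i"
    using * by (simp add: inj_eq[OF permutes_inj[OF permutes_inv[OF w]]])
  ultimately show "(i, j) \<in> perm_inv n w" by (simp add: perm_inv_eq_positions[OF w])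
qed

lemma G_permutation_iff_Max:
  "G_permutation n E w \<longleftrightarrow>
    (\<forall>v\<in>{1..n}. Max {u \<in> {1..n}. inv w u \<le> inv w v} \<in> prefix_component n E (inv w) v)"
proof -
  have "G_permutation n E w \<longleftrightarrow>
      (\<forall>v\<in>w ` {1..n}. Max {u \<in> {1..n}. inv w u \<le> inv w v} \<in> prefix_component n E (inv w) v)"
    unfolding G_permutation_def prefix_component_def ball_simps using w
    by (simp only: image_prefix_permutes[OF w] cong: ball_cong) simp
  then show ?thesis by (simp only: permutes_image[OF w])
qed

text \<open>Let \<open>k > i\<close> be listed before \<open>i\<close>. The component of
  \<open>i\<close> in the prefix up to \<open>i\<close> contains the maximum of the prefix; if
  \<open>k\<close> were outside, it would lie strictly between two vertices of the component and be
  adjacent to it, although it belongs to the same prefix. Conversely, the maximum of a prefix is its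
  last letter or forms an inversion with it, which places it in the tube.\<close>

lemma G_permutation_iff_inv:
  assumes rf: "right_filled E"
  shows "G_permutation n E w \<longleftrightarrow> perm_inv n w = tubing_inv n (Psi n E w)"
proof
  assume G: "G_permutation n E w"
  show "perm_inv n w = tubing_inv n (Psi n E w)"
  proof
    show "perm_inv n w \<subseteq> tubing_inv n (Psi n E w)"
    proof clarify
      fix i k assume "(i, k) \<in> perm_inv n w"
      then have ik: "i \<in> {1..n}" "k \<in> {1..n}" "i < k" "inv w k < inv w i"
        by (simp_all add: perm_inv_eq_positions[OF w])
      define S where "S = {u \<in> {1..n}. inv w u \<le> inv w i}"
      define C where "C = component_of E S i"
      have iS: "i \<in> S" and kS: "k \<in> S" and "finite S" using ik by (auto simp: S_def)
      have iC: "i \<in> C" and conn: "connected_on E C"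
        unfolding C_def using component_of_self connected_on_component_of[OF sym] iS by blast+
      have M: "Max S \<in> C"
        using G ik(1) unfolding G_permutation_iff_Max prefix_component_def C_def S_def by blast
      have kM: "k \<le> Max S" by (rule Max_ge[OF \<open>finite S\<close> kS])
      have "k \<in> C"
      proof (rule ccontr)
        assume nk: "k \<notin> C"
        then have "k \<noteq> Max S" using M by blast
        then have kM: "k < Max S" using kM by simp
        obtain v where "v \<in> C" "(k, v) \<in> E"
          by (rule right_filled_adjacent[OF rf conn iC M ik(3) kM nk])
        moreover have "(v, k) \<in> E" using \<open>(k, v) \<in> E\<close> by (rule symD[OF sym])
        ultimately show False using component_of_step[OF _ _ kS] nk unfolding C_def by blast
      qed
      then show "(i, k) \<in> tubing_inv n (Psi n E w)"
        using ik unfolding tubing_inv_Psi prefix_component_def C_def S_def by blast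
    qed
  qed (rule tubing_inv_Psi_subset)
next
  assume eq: "perm_inv n w = tubing_inv n (Psi n E w)"
  show "G_permutation n E w"
    unfolding G_permutation_iff_Max
  proof
    fix v assume v: "v \<in> {1..n}"
    define S where "S = {u \<in> {1..n}. inv w u \<le> inv w v}"
    have "v \<in> S" "finite S" using v by (auto simp: S_def)
    have MS: "Max S \<in> {1..n}" "inv w (Max S) \<le> inv w v"
      using Max_in[OF \<open>finite S\<close>] \<open>v \<in> S\<close> unfolding S_def by blast+
    have "v \<le> Max S" by (rule Max_ge[OF \<open>finite S\<close> \<open>v \<in> S\<close>])
    have "Max S \<in> prefix_component n E (inv w) v"
    proof (cases "v = Max S")
      case True
      then show ?thesis using prefix_component_self[OF v, of E "inv w"] by simp
    next
      case False
      then have "v < Max S" using \<open>v \<le> Max S\<close> by simp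
      moreover have "inv w (Max S) \<noteq> inv w v"
        using False by (simp add: inj_eq[OF permutes_inj[OF permutes_inv[OF w]]])
      ultimately have "(v, Max S) \<in> perm_inv n w"
        using MS v unfolding perm_inv_eq_positions[OF w] by simp
      then show ?thesis unfolding eq tubing_inv_Psi by blast
    qed
    then show "Max {u \<in> {1..n}. inv w u \<le> inv w v} \<in> prefix_component n E (inv w) v"
      unfolding S_def .
  qed
qed

end

text \<open>By right-filledness, membership of \<open>j > i\<close> in the tube of \<open>i\<close> is witnessed among the
  vertices that form an inversion with \<open>i\<close>.\<close>

lemma tubing_inv_Psi_mono:
  assumes sym: "sym E" and rf: "right_filled E"
    and u: "u permutes {1..n}" and v: "v permutes {1..n}" and le: "perm_inv n u \<subseteq> perm_inv n v"
  shows "tubing_inv n (Psi n E u) \<subseteq> tubing_inv n (Psi n E v)"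
proof clarify
  fix i j assume "(i, j) \<in> tubing_inv n (Psi n E u)"
  then have ij: "i \<in> {1..n}" "j \<in> {1..n}" "i < j" and j: "j \<in> prefix_component n E (inv u) i"
    unfolding tubing_inv_Psi[OF sym u] by blast+
  let ?I = "prefix_component n E (inv u) i"
  have "connected_on E ?I" using tube_prefix_component[OF sym ij(1)] by (simp add: tube_def)
  then have "j \<in> component_of E (?I \<inter> {i..}) i"
    using right_filled_component_of_atLeast[OF rf] prefix_component_self[OF ij(1)] j ij(3) by simp
  moreover have "?I \<inter> {i..} \<subseteq> {x \<in> {1..n}. inv v x \<le> inv v i}"
  proof
    fix x assume x: "x \<in> ?I \<inter> {i..}"
    then have x': "x \<in> {1..n}" "inv u x \<le> inv u i" using prefix_componentD by blast+
    show "x \<in> {x \<in> {1..n}. inv v x \<le> inv v i}"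
    proof (cases "x = i")
      case False
      then have "inv u x \<noteq> inv u i" by (simp add: inj_eq[OF permutes_inj[OF permutes_inv[OF u]]])
      then have "(i, x) \<in> perm_inv n u"
        using x x' ij False by (auto simp: perm_inv_eq_positions[OF u])
      then have "(i, x) \<in> perm_inv n v" using le by blast
      then show ?thesis by (simp add: perm_inv_eq_positions[OF v])
    qed (use x' in simp)
  qed
  ultimately have "j \<in> prefix_component n E (inv v) i"
    unfolding prefix_component_def using component_of_mono by blast
  then show "(i, j) \<in> tubing_inv n (Psi n E v)" unfolding tubing_inv_Psi[OF sym v] using ij by blast
qed

text \<open>The permutation with inversion set \<open>tubing_inv n X\<close> lists the other
  vertices of each tube before its top: larger ones form inversions with the top, smaller ones do
  not, because the top is not in their tubes. It is thus a linear extension, whose prefix components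
  are \<open>X\<close>.\<close>

lemma maximal_tubing_G_permutation:
  assumes sym: "sym E" and rf: "right_filled E" and X: "maximal_tubing n E X"
  obtains w where "w permutes {1..n}" "Psi n E w = X" "perm_inv n w = tubing_inv n X"
proof -
  obtain w where w: "w permutes {1..n}" and eq: "perm_inv n w = tubing_inv n X"
    using biclosed_imp_perm_inv[OF biclosed_tubing_inv[OF sym rf X]] by blast
  have "inv w j \<le> inv w i" if i: "i \<in> {1..n}" and j: "j \<in> least_tube X i" for i j
  proof -
    have jn: "j \<in> {1..n}" using least_tube_bounds[OF sym X j i] .
    consider "j = i" | "i < j" | "j < i" by linarith
    then show ?thesis
    proof cases
      case 2
      then have "(i, j) \<in> perm_inv n w" using i j jn unfolding eq tubing_inv_def by blast
      then show ?thesis by (simp add: perm_inv_eq_positions[OF w])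
    next
      case 3
      then have "i \<notin> least_tube X j" using least_tube_antisym[OF sym X j _ jn i] by blast
      then have "(j, i) \<notin> perm_inv n w" unfolding eq tubing_inv_def by blast
      then show ?thesis using i jn 3 by (simp add: perm_inv_eq_positions[OF w])
    qed simp
  qed
  then have "prefix_component n E (inv w) ` {1..n} = X"
    using linear_extension_prefix_components[OF sym X permutes_inj_on[OF permutes_inv[OF w]]] by blast
  then show ?thesis using that[OF w _ eq] Psi_eq_prefix_components[OF w] by simp
qed

lemma tubing_inv_inject:
  assumes "sym E" "right_filled E" "maximal_tubing n E X" "maximal_tubing n E Y"
    and eq: "tubing_inv n X = tubing_inv n Y"
  shows "X = Y"
proof -
  obtain u where u: "u permutes {1..n}" "Psi n E u = X" "perm_inv n u = tubing_inv n X"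
    using maximal_tubing_G_permutation[OF assms(1-3)] by blast
  obtain v where v: "v permutes {1..n}" "Psi n E v = Y" "perm_inv n v = tubing_inv n Y"
    using maximal_tubing_G_permutation[OF assms(1,2,4)] by blast
  have "u = v" using perm_inv_inject[OF u(1) v(1)] u(3) v(3) eq by simp
  then show ?thesis using u(2) v(2) by simp
qed

section \<open>Flips\<close>

lemma component_of_Diff_singleton:
  assumes "sym E" "v \<in> S" "a \<notin> component_of E S v"
  shows "component_of E (S - {a}) v = component_of E S v"
proof
  show "component_of E (S - {a}) v \<subseteq> component_of E S v" by (rule component_of_mono) blast
  show "component_of E S v \<subseteq> component_of E (S - {a}) v"
    using assms connected_on_component_of[OF assms(1,2)] component_of_self[OF assms(2)]
      component_of_subset[of E S v]
    by (intro connected_subset_component_of) blast+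
qed

text \<open>Let \<open>P\<close> be the prefix ending with the letters \<open>a = w i\<close> and
  \<open>b = w (Suc i)\<close>; only their components can change. If they lie in different
  components of \<open>P\<close>, neither is affected by removing the other and the tubing stays. If
  they share a component, it passes from \<open>b\<close> to \<open>a\<close>, so only the tube of
  \<open>a\<close> disappears, replaced by a tube with the larger top \<open>b\<close>.\<close>

lemma Psi_adjacent_transposition:
  assumes sym: "sym E" and w: "w permutes {1..n}" and i: "1 \<le> i" "i < n" "w i < w (Suc i)"
  shows "Psi n E (w \<circ> transpose i (Suc i)) = Psi n E w \<or>
    flip n E (Psi n E w) (Psi n E (w \<circ> transpose i (Suc i)))"
proof -
  define w' where "w' = w \<circ> transpose i (Suc i)"
  define a b where "a = w i" and "b = w (Suc i)"
  have w': "w' permutes {1..n}"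
    unfolding w'_def by (rule perm_inv_adjacent_transposition(1)[OF w i])
  have pos: "inv w' u = (if u = a then Suc i else if u = b then i else inv w u)" for u
    unfolding w'_def a_def b_def by (rule perm_inv_adjacent_transposition(2)[OF w i])
  have ab: "a < b" using i by (simp add: a_def b_def)
  have "i \<in> {1..n}" "Suc i \<in> {1..n}" using i(1,2) by auto
  then have abn: "a \<in> {1..n}" "b \<in> {1..n}" unfolding a_def b_def by (simp_all only: permutes_in_image[OF w])
  have qab: "inv w a = i" "inv w b = Suc i"
    unfolding a_def b_def by (rule permutes_inverses(2)[OF w])+
  have ne: "inv w u = i \<longleftrightarrow> u = a" "inv w u = Suc i \<longleftrightarrow> u = b" for u
    unfolding a_def b_def using permutes_inv_eq[OF w] by metis+
  define P where "P = {u \<in> {1..n}. inv w u \<le> Suc i}"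
  have abP: "a \<in> P" "b \<in> P" using abn qab by (auto simp: P_def)
  have le: "inv w u \<le> i \<longleftrightarrow> inv w u \<le> Suc i \<and> u \<noteq> b" for u
    using ne(2)[of u] by (cases "u = b") (auto simp: le_Suc_eq)
  have le': "inv w' u \<le> inv w' b \<longleftrightarrow> inv w u \<le> Suc i \<and> u \<noteq> a" for u
    using ab qab le[of u] by (cases "u = a"; cases "u = b") (auto simp: pos)
  have le'': "inv w' u \<le> inv w' a \<longleftrightarrow> inv w u \<le> Suc i" for u
    using ab qab le[of u] by (cases "u = a"; cases "u = b") (auto simp: pos)
  have pre: "{u \<in> {1..n}. inv w u \<le> inv w a} = P - {b}" unfolding P_def qab le by blast
  have pre': "{u \<in> {1..n}. inv w' u \<le> inv w' b} = P - {a}" unfolding P_def le' by blast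
  have pre'': "{u \<in> {1..n}. inv w' u \<le> inv w' a} = P" unfolding P_def le'' by blast
  define pc where "pc = prefix_component n E (inv w)"
  define pc' where "pc' = prefix_component n E (inv w')"
  have pca: "pc a = component_of E (P - {b}) a" unfolding pc_def prefix_component_def pre ..
  have pcb: "pc b = component_of E P b" unfolding pc_def prefix_component_def qab P_def ..
  have pca': "pc' a = component_of E P a" unfolding pc'_def prefix_component_def pre'' ..
  have pcb': "pc' b = component_of E (P - {a}) b" unfolding pc'_def prefix_component_def pre' ..
  have other: "pc' v = pc v" if "v \<noteq> a" "v \<noteq> b" for v
  proof -
    have "inv w v \<noteq> i" "inv w v \<noteq> Suc i" using that ne by blast+
    then have "inv w' u \<le> inv w' v \<longleftrightarrow> inv w u \<le> inv w v" for u
      using that ab qab by (cases "u = a"; cases "u = b") (auto simp: pos)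
    then show ?thesis unfolding pc_def pc'_def prefix_component_def by simp
  qed
  have X: "Psi n E w = pc ` {1..n}" and Y: "Psi n E w' = pc' ` {1..n}"
    unfolding pc_def pc'_def using Psi_eq_prefix_components w w' by blast+
  have mX: "maximal_tubing n E (Psi n E w)" and mY: "maximal_tubing n E (Psi n E w')"
    using maximal_tubing_Psi[OF sym] w w' by blast+
  show ?thesis
  proof (cases "a \<in> component_of E P b")
    case False
    then have "b \<notin> component_of E P a" using component_of_sym[OF sym] component_of_self abP by metis
    then have "pc' a = pc a" unfolding pca pca' using component_of_Diff_singleton[OF sym abP(1)] by simp
    moreover have "pc' b = pc b"
      unfolding pcb pcb' using component_of_Diff_singleton[OF sym abP(2) False] .
    ultimately have "pc' v = pc v" for v using other[of v] by (cases "v = a"; cases "v = b") simp_all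
    then show ?thesis using X Y by (simp add: w'_def)
  next
    case True
    then have K: "pc' a = pc b" unfolding pca' pcb using component_of_sym[OF sym] by blast
    have inj: "inj_on pc {1..n}"
      unfolding pc_def by (rule inj_on_prefix_component[OF permutes_inj_on[OF permutes_inv[OF w]]])
    have aI: "a \<in> pc a" unfolding pc_def by (rule prefix_component_self[OF abn(1)])
    have "a \<notin> pc' b" unfolding pcb' using component_of_subset by blast
    then have IJ: "pc a \<noteq> pc' b" using aI by blast
    have "pc ` {1..n} - {pc a} = pc ` ({1..n} - {a})"
      using inj_on_image_set_diff[OF inj, of "{1..n}" "{a}"] abn by simp
    moreover have "pc' ` {1..n} = pc ` ({1..n} - {a}) \<union> {pc' b}"
    proof
      show "pc' ` {1..n} \<subseteq> pc ` ({1..n} - {a}) \<union> {pc' b}"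
      proof
        fix Z assume "Z \<in> pc' ` {1..n}"
        then obtain v where v: "v \<in> {1..n}" "Z = pc' v" by blast
        show "Z \<in> pc ` ({1..n} - {a}) \<union> {pc' b}"
        proof (cases "v = a")
          case True
          then show ?thesis using v K abn ab by blast
        next
          case False
          then show ?thesis using v other[of v] by (cases "v = b") auto
        qed
      qed
      show "pc ` ({1..n} - {a}) \<union> {pc' b} \<subseteq> pc' ` {1..n}"
      proof
        fix Z assume "Z \<in> pc ` ({1..n} - {a}) \<union> {pc' b}"
        then consider "Z = pc' b" | v where "v \<in> {1..n}" "v \<noteq> a" "Z = pc v" by blast
        then show "Z \<in> pc' ` {1..n}"
        proof cases
          case 2
          then show ?thesis using K other[of v] abn by (cases "v = b") auto
        qed (use abn in blast)
      qed
    qed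
    ultimately have YX: "Psi n E w' = (Psi n E w - {pc a}) \<union> {pc' b}" using X Y by simp
    have "tube_top (Psi n E w) (pc a) = a"
      using tube_top_least_tube[OF sym mX abn(1)] least_tube_Psi[OF sym w abn(1)]
      by (simp add: pc_def)
    moreover have "tube_top (Psi n E w') (pc' b) = b"
      using tube_top_least_tube[OF sym mY abn(2)] least_tube_Psi[OF sym w' abn(2)]
      by (simp add: pc'_def)
    moreover have "pc a \<in> Psi n E w" using X abn by blast
    ultimately have "flip n E (Psi n E w) (Psi n E w')"
      unfolding flip_def using mX mY YX IJ ab by metis
    then show ?thesis by (simp add: w'_def)
  qed
qed

text \<open>If \<open>u\<close> differs from \<open>v\<close>, some adjacent letters of
  \<open>u\<close> stand in the other order in \<open>v\<close>. They ascend in \<open>u\<close>,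
  since an inversion of \<open>u\<close> is one of \<open>v\<close>. Exchanging them adds an
  inversion that \<open>v\<close> has, so fewer are missing.\<close>

lemma flips_Psi:
  assumes sym: "sym E" and "u permutes {1..n}" and v: "v permutes {1..n}"
    and "perm_inv n u \<subseteq> perm_inv n v"
  shows "(flip n E)\<^sup>*\<^sup>* (Psi n E u) (Psi n E v)"
  using assms(2,4)
proof (induction "card (perm_inv n v - perm_inv n u)" arbitrary: u rule: less_induct)
  case less
  note u = less.prems(1) and le = less.prems(2)
  show ?case
  proof (cases "u = v")
    case False
    then obtain i where i: "1 \<le> i" "i < n" and desc: "\<not> inv v (u i) < inv v (u (Suc i))"
      using permutes_eq_if_ascents[OF u v] by blast
    define a b where "a = u i" and "b = u (Suc i)"
    have "i \<in> {1..n}" "Suc i \<in> {1..n}" using i by auto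
    then have abn: "a \<in> {1..n}" "b \<in> {1..n}"
      unfolding a_def b_def by (simp_all only: permutes_in_image[OF u])
    have ne: "a \<noteq> b" unfolding a_def b_def by (simp add: inj_eq[OF permutes_inj[OF u]])
    have pos: "inv u a = i" "inv u b = Suc i"
      unfolding a_def b_def by (rule permutes_inverses(2)[OF u])+
    have "inv v a \<noteq> inv v b" using ne by (simp add: inj_eq[OF permutes_inj[OF permutes_inv[OF v]]])
    then have vba: "inv v b < inv v a" using desc by (simp add: a_def b_def)
    have ab: "a < b"
    proof (rule ccontr)
      assume "\<not> a < b"
      then have "(b, a) \<in> perm_inv n u" using abn ne pos by (simp add: perm_inv_eq_positions[OF u])
      then have "(b, a) \<in> perm_inv n v" using le by blast
      then show False using vba by (simp add: perm_inv_eq_positions[OF v])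
    qed
    then have uab: "u i < u (Suc i)" by (simp add: a_def b_def)
    have abv: "(a, b) \<in> perm_inv n v" using abn ab vba by (simp add: perm_inv_eq_positions[OF v])
    have abu: "(a, b) \<notin> perm_inv n u" by (simp add: perm_inv_eq_positions[OF u] pos)
    let ?u = "u \<circ> transpose i (Suc i)"
    have ins: "perm_inv n ?u = insert (a, b) (perm_inv n u)"
      unfolding a_def b_def by (rule perm_inv_adjacent_transposition(3)[OF u i uab])
    have sub: "perm_inv n ?u \<subseteq> perm_inv n v" unfolding ins using abv le by simp
    have "perm_inv n v - perm_inv n ?u \<subset> perm_inv n v - perm_inv n u" unfolding ins using abv abu by blast
    moreover have "finite (perm_inv n v - perm_inv n u)"
      by (rule finite_subset[of _ "{1..n} \<times> {1..n}"]) (auto simp: perm_inv_eq_positions[OF v])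
    ultimately have "card (perm_inv n v - perm_inv n ?u) < card (perm_inv n v - perm_inv n u)"
      by (intro psubset_card_mono)
    then have "(flip n E)\<^sup>*\<^sup>* (Psi n E ?u) (Psi n E v)"
      using less.hyps perm_inv_adjacent_transposition(1)[OF u i uab] sub by blast
    then show ?thesis using Psi_adjacent_transposition[OF sym u i uab]
      by (metis converse_rtranclp_into_rtranclp)
  qed simp
qed

text \<open>The tube \<open>K\<close> with top \<open>b\<close> in \<open>X\<close> has top
  \<open>a\<close> in \<open>Y\<close>, so the tube of \<open>a\<close> grows from \<open>I\<close>
  to \<open>K\<close> and only that of \<open>b\<close> can lose vertices. Those above
  \<open>b\<close> stay: right-filledness joins them to \<open>b\<close> inside
  \<open>K \<inter> {b..}\<close>, and this component lies in the \<open>Y\<close>-tube of one of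
  its vertices \<open>m\<close>. Here \<open>m\<close> is not \<open>a\<close>, as
  \<open>a < b\<close>; were it not \<open>b\<close> either, its tube would be unchanged and contain
  \<open>b\<close>, while \<open>m\<close> lies in the tube \<open>K\<close> of
  \<open>b\<close>.\<close>

lemma flip_tubing_inv_mono:
  assumes sym: "sym E" and rf: "right_filled E" and flip: "flip n E X Y"
  shows "tubing_inv n X \<subseteq> tubing_inv n Y"
proof -
  obtain I J where X: "maximal_tubing n E X" and Y: "maximal_tubing n E Y" and IX: "I \<in> X"
    and IJ: "I \<noteq> J" and YX: "Y = (X - {I}) \<union> {J}" and top: "tube_top X I < tube_top Y J"
    using flip unfolding flip_def by blast
  note Xeq = maximal_tubing_eq[OF sym X] and Yeq = maximal_tubing_eq[OF sym Y]
  note Xin = least_tube_in[OF sym X] and Yin = least_tube_in[OF sym Y]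
  note Xinj = inj_onD[OF inj_on_least_tube[OF sym X]] and Yinj = inj_onD[OF inj_on_least_tube[OF sym Y]]
  obtain a where a: "a \<in> {1..n}" "I = least_tube X a" using IX Xeq by blast
  obtain b where b: "b \<in> {1..n}" "J = least_tube Y b" using YX Yeq by blast
  have ab: "a < b"
    using top tube_top_least_tube[OF sym X a(1)] tube_top_least_tube[OF sym Y b(1)] a b by simp
  \<comment> \<open>Otherwise \<open>Y\<close> would be \<open>X\<close> without \<open>I\<close>,
    contradicting the maximality of \<open>Y\<close>.\<close>
  have JX: "J \<notin> X"
  proof
    assume "J \<in> X"
    then have "Y \<subseteq> X" "I \<notin> Y" using YX IJ by auto
    moreover have "X = Y" using X Y \<open>Y \<subseteq> X\<close> unfolding maximal_tubing_def by blast
    ultimately show False using IX by blast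
  qed
  have same: "least_tube Y i = least_tube X i" if i: "i \<in> {1..n}" "i \<noteq> a" "i \<noteq> b" for i
  proof
    have "least_tube X i \<in> Y" using Xin[OF i(1)] Xinj[of i a] i a YX by blast
    then show "least_tube Y i \<subseteq> least_tube X i"
      using least_tube_subset least_tube_self by blast
    have "least_tube Y i \<in> X" using Yin[OF i(1)] Yinj[of i b] i b YX by blast
    then show "least_tube X i \<subseteq> least_tube Y i"
      using least_tube_subset least_tube_self by blast
  qed
  define K where "K = least_tube X b"
  have "K \<in> X" unfolding K_def using Xin[OF b(1)] .
  moreover have "K \<noteq> I" unfolding K_def a(2) using Xinj[of b a] a b ab by auto
  ultimately have "K \<in> Y" using YX by blast
  \<comment> \<open>The top of \<open>K\<close> in \<open>Y\<close> is not \<open>b\<close>, whose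
    tube \<open>J\<close> is new, nor a vertex keeping its tube, since \<open>K\<close> belongs to
    \<open>b\<close> in \<open>X\<close>. Only \<open>a\<close> remains.\<close>
  then obtain i where i: "i \<in> {1..n}" "K = least_tube Y i" using Yeq by blast
  have "i \<noteq> b" using i \<open>K \<in> X\<close> JX b by blast
  have "i = a"
  proof (rule ccontr)
    assume "i \<noteq> a"
    then have "least_tube X i = least_tube X b" using same i \<open>i \<noteq> b\<close> K_def by simp
    then show False using Xinj i b \<open>i \<noteq> b\<close> by blast
  qed
  then have KY: "K = least_tube Y a" using i by simp
  have "a \<in> K" unfolding KY by (rule least_tube_self)
  then have IK: "least_tube X a \<subseteq> K" unfolding K_def using least_tube_mono[OF sym X _ b(1)] by blast
  have bK: "b \<in> K" unfolding K_def by (rule least_tube_self)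
  have Kn: "K \<subseteq> {1..n}" and Kc: "connected_on E K"
    using tube_least_tube[OF sym X b(1)] unfolding K_def tube_def by blast+
  have "j \<in> least_tube Y b" if j: "j \<in> K" "b < j" for j
  proof -
    let ?S = "component_of E (K \<inter> {b..}) b"
    have "j \<in> ?S" using right_filled_component_of_atLeast[OF rf Kc bK] j by simp
    have "b \<in> K \<inter> {b..}" using bK by simp
    then have bS: "b \<in> ?S" by (rule component_of_self)
    have Sc: "connected_on E ?S" by (rule connected_on_component_of[OF sym \<open>b \<in> K \<inter> {b..}\<close>])
    have SK: "?S \<subseteq> K \<inter> {b..}" by (rule component_of_subset)
    then have "?S \<subseteq> {1..n}" using Kn by blast
    then obtain m where m: "m \<in> ?S" "?S \<subseteq> least_tube Y m"
      using connected_subset_least_tube[OF sym Y Sc] by blast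
    have mK: "m \<in> K" "b \<le> m" "m \<in> {1..n}" using m SK Kn by auto
    have "m = b"
    proof (rule ccontr)
      assume "m \<noteq> b"
      then have "least_tube Y m = least_tube X m" using same mK ab by simp
      then have "b \<in> least_tube X m" using m bS by blast
      then have "m = b" using least_tube_antisym[OF sym X _ _ mK(3) b(1)] mK(1) K_def by blast
      then show False using \<open>m \<noteq> b\<close> by blast
    qed
    then show ?thesis using m \<open>j \<in> ?S\<close> by blast
  qed
  then have "j \<in> least_tube Y i" if "i \<in> {1..n}" "i < j" "j \<in> least_tube X i" for i j
    using that same[of i] IK KY K_def by (cases "i = a"; cases "i = b") auto
  then show ?thesis unfolding tubing_inv_def by blast
qed

lemma tubing_le_iff:
  assumes sym: "sym E" and rf: "right_filled E"
    and X: "maximal_tubing n E X" and Y: "maximal_tubing n E Y"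
  shows "(flip n E)\<^sup>*\<^sup>* X Y \<longleftrightarrow> tubing_inv n X \<subseteq> tubing_inv n Y"
proof
  assume "(flip n E)\<^sup>*\<^sup>* X Y"
  then show "tubing_inv n X \<subseteq> tubing_inv n Y"
    by (induction rule: rtranclp_induct) (use flip_tubing_inv_mono[OF sym rf] in blast)+
next
  assume le: "tubing_inv n X \<subseteq> tubing_inv n Y"
  obtain u where u: "u permutes {1..n}" "Psi n E u = X" "perm_inv n u = tubing_inv n X"
    using maximal_tubing_G_permutation[OF sym rf X] by blast
  obtain v where v: "v permutes {1..n}" "Psi n E v = Y" "perm_inv n v = tubing_inv n Y"
    using maximal_tubing_G_permutation[OF sym rf Y] by blast
  show "(flip n E)\<^sup>*\<^sup>* X Y" using flips_Psi[OF sym u(1) v(1)] u v le by simp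
qed

section \<open>Lattices represented by sets\<close>

context
  fixes L :: "('a, 'b) gorder_scheme" (structure) and f :: "'a \<Rightarrow> 'c set"
  assumes eq: "eq L = (=)" and inj: "inj_on f (carrier L)"
    and le: "\<And>x y. \<lbrakk>x \<in> carrier L; y \<in> carrier L\<rbrakk> \<Longrightarrow> x \<sqsubseteq> y \<longleftrightarrow> f x \<subseteq> f y"
begin

lemma partial_order_by_sets: "partial_order L"
proof unfold_locales
  fix x y assume "x \<sqsubseteq> y" "y \<sqsubseteq> x" "x \<in> carrier L" "y \<in> carrier L"
  then show "x .= y" using le inj eq by (auto dest: inj_onD)
qed (auto simp: eq le)

text \<open>Only sets \<open>f z\<close> with \<open>z\<close> in the carrier are compared, so
  \<open>f m\<close> is the largest represented set inside the intersection and can be smaller than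
  it, as happens in the weak order.\<close>

lemma greatest_Lower_by_sets:
  assumes "x \<in> carrier L" "y \<in> carrier L" "m \<in> carrier L"
    and m: "\<And>z. z \<in> carrier L \<Longrightarrow> f z \<subseteq> f m \<longleftrightarrow> f z \<subseteq> f x \<inter> f y"
  shows "greatest L m (Lower L {x, y})"
proof (rule greatest_LowerI)
  show "m \<sqsubseteq> z" if "z \<in> {x, y}" for z using m[of m] assms(1-3) that by (auto simp: le)
  show "z \<sqsubseteq> m" if "z \<in> Lower L {x, y}" for z
  proof -
    have "z \<in> carrier L" "z \<sqsubseteq> x" "z \<sqsubseteq> y" using that assms(1,2) unfolding Lower_def by blast+
    then show ?thesis using m[of z] assms(1-3) by (simp add: le)
  qed
qed (use assms(1-3) in simp_all)

lemma least_Upper_by_sets: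
  assumes "x \<in> carrier L" "y \<in> carrier L" "s \<in> carrier L"
    and s: "\<And>z. z \<in> carrier L \<Longrightarrow> f s \<subseteq> f z \<longleftrightarrow> f x \<union> f y \<subseteq> f z"
  shows "least L s (Upper L {x, y})"
proof (rule least_UpperI)
  show "z \<sqsubseteq> s" if "z \<in> {x, y}" for z using s[of s] assms(1-3) that by (auto simp: le)
  show "s \<sqsubseteq> z" if "z \<in> Upper L {x, y}" for z
  proof -
    have "z \<in> carrier L" "x \<sqsubseteq> z" "y \<sqsubseteq> z" using that assms(1,2) unfolding Upper_def by blast+
    then show ?thesis using s[of z] assms(1-3) by (simp add: le)
  qed
qed (use assms(1-3) in simp_all)

lemma lattice_by_sets:
  assumes "\<And>x y. \<lbrakk>x \<in> carrier L; y \<in> carrier L\<rbrakk> \<Longrightarrow>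
      \<exists>s\<in>carrier L. \<forall>z\<in>carrier L. f s \<subseteq> f z \<longleftrightarrow> f x \<union> f y \<subseteq> f z"
    and "\<And>x y. \<lbrakk>x \<in> carrier L; y \<in> carrier L\<rbrakk> \<Longrightarrow>
      \<exists>m\<in>carrier L. \<forall>z\<in>carrier L. f z \<subseteq> f m \<longleftrightarrow> f z \<subseteq> f x \<inter> f y"
  shows "lattice L"
proof -
  interpret partial_order L by (rule partial_order_by_sets)
  show ?thesis
  proof unfold_locales
    fix x y assume xy: "x \<in> carrier L" "y \<in> carrier L"
    show "\<exists>s. least L s (Upper L {x, y})"
      using assms(1)[OF xy] least_Upper_by_sets[OF xy] by metis
    show "\<exists>m. greatest L m (Lower L {x, y})"
      using assms(2)[OF xy] greatest_Lower_by_sets[OF xy] by metis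
  qed
qed

lemma meet_by_sets:
  assumes "x \<in> carrier L" "y \<in> carrier L" "m \<in> carrier L"
    and "\<And>z. z \<in> carrier L \<Longrightarrow> f z \<subseteq> f m \<longleftrightarrow> f z \<subseteq> f x \<inter> f y"
  shows "x \<sqinter> y = m"
proof -
  interpret partial_order L by (rule partial_order_by_sets)
  have m: "greatest L m (Lower L {x, y})" using greatest_Lower_by_sets assms by blast
  then show ?thesis unfolding meet_def inf_def
    by (intro some_equality) (auto intro: greatest_unique)
qed

end

section \<open>Instances: the weak order, forests and maximal tubings\<close>

lemma lattice_weak_order: "lattice (weak_order n)"
proof (rule lattice_by_sets[of _ "perm_inv n"])
  show "inj_on (perm_inv n) (carrier (weak_order n))"
    using perm_inv_inject by (intro inj_onI) (simp add: weak_order_def)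
next
  fix x y assume "x \<in> carrier (weak_order n)" "y \<in> carrier (weak_order n)"
  then have xy: "x permutes {1..n}" "y permutes {1..n}" by (simp_all add: weak_order_def)
  show "\<exists>s\<in>carrier (weak_order n). \<forall>z\<in>carrier (weak_order n).
      perm_inv n s \<subseteq> perm_inv n z \<longleftrightarrow> perm_inv n x \<union> perm_inv n y \<subseteq> perm_inv n z"
    by (rule weak_order_join[OF xy]) (auto simp: weak_order_def)
  show "\<exists>m\<in>carrier (weak_order n). \<forall>z\<in>carrier (weak_order n).
      perm_inv n z \<subseteq> perm_inv n m \<longleftrightarrow> perm_inv n z \<subseteq> perm_inv n x \<inter> perm_inv n y"
    by (rule weak_order_meet[OF xy]) (auto simp: weak_order_def)
qed (simp_all add: weak_order_def)

text \<open>The \<open>n\<close> principal ideals are pairwise compatible, and distinct by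
  antisymmetry, so counting gives maximality. By transitivity the ideal of \<open>i\<close> is the
  least one containing \<open>i\<close>, which identifies the two notions of inversion.\<close>

lemma forest_tubing_maximal:
  assumes sym: "sym E" and T: "G_forest n E T"
  shows "maximal_tubing n E (forest_tubing n T)"
    and "tubing_inv n (forest_tubing n T) = forest_inv T"
proof -
  have po: "partial_order_on {1..n} T" using T by (simp add: G_forest_def forest_poset_def)
  have bd: "i \<in> {1..n} \<and> j \<in> {1..n}" if "(i, j) \<in> T" for i j
    using po that unfolding partial_order_on_def preorder_on_def by blast
  have rfl: "(i, i) \<in> T" if "i \<in> {1..n}" for i
    using po that unfolding partial_order_on_def preorder_on_def by (auto dest: refl_onD)
  have trs: "(i, k) \<in> T" if "(i, j) \<in> T" "(j, k) \<in> T" for i j k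
    using po that unfolding partial_order_on_def preorder_on_def by (auto dest: transD)
  have asym: "i = j" if "(i, j) \<in> T" "(j, i) \<in> T" for i j
    using po that unfolding partial_order_on_def by (auto dest: antisymD)
  have mono: "under T i \<subseteq> under T k" if "(i, k) \<in> T" for i k
    using trs that by (auto simp: under_def)
  have "compatible n E (under T i) (under T k)" if "i \<in> {1..n}" "k \<in> {1..n}" for i k
    using T that mono[of i k] mono[of k i] unfolding G_forest_def compatible_def by blast
  then have "tubing n E (forest_tubing n T)"
    using T unfolding tubing_def forest_tubing_def G_forest_def by blast
  moreover have "inj_on (under T) {1..n}"
  proof (rule inj_onI)
    fix i j assume "i \<in> {1..n}" "j \<in> {1..n}" "under T i = under T j"
    then have "(i, j) \<in> T" "(j, i) \<in> T" using rfl by (auto simp: under_def)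
    then show "i = j" by (rule asym)
  qed
  then have "card (forest_tubing n T) = n" by (simp add: forest_tubing_def card_image)
  ultimately show "maximal_tubing n E (forest_tubing n T)" using maximal_tubingI_card[OF sym] by blast
  have "least_tube (forest_tubing n T) i = under T i" if "i \<in> {1..n}" for i
  proof
    have "under T i \<in> forest_tubing n T" "i \<in> under T i"
      using that rfl[OF that] unfolding forest_tubing_def under_def by blast+
    then show "least_tube (forest_tubing n T) i \<subseteq> under T i" by (rule least_tube_subset)
    show "under T i \<subseteq> least_tube (forest_tubing n T) i"
      unfolding least_tube_def forest_tubing_def under_def using trs by blast
  qed
  then show "tubing_inv n (forest_tubing n T) = forest_inv T"
    unfolding tubing_inv_def forest_inv_def using bd by (auto simp: under_def)
qed

context
  fixes n :: nat and E :: "nat rel"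
  assumes sym: "sym E" and rf: "right_filled E"
begin

text \<open>For the direction from right to left, take the \<open>G\<close>-permutation
  \<open>z\<close> of \<open>Z\<close>. Its inversions are those of \<open>Z\<close>, hence shared
  by \<open>x\<close> and \<open>y\<close>, so \<open>z\<close> lies below \<open>m\<close>;
  applying \<open>Psi\<close> puts \<open>Z\<close> below \<open>Psi n E m\<close>.\<close>

lemma tubing_inv_Psi_meet:
  assumes m: "m permutes {1..n}" and x: "x permutes {1..n}" and y: "y permutes {1..n}"
    and glb: "\<And>z. z permutes {1..n} \<Longrightarrow>
      perm_inv n z \<subseteq> perm_inv n m \<longleftrightarrow> perm_inv n z \<subseteq> perm_inv n x \<inter> perm_inv n y"
    and Z: "maximal_tubing n E Z"
  shows "tubing_inv n Z \<subseteq> tubing_inv n (Psi n E m) \<longleftrightarrow>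
    tubing_inv n Z \<subseteq> tubing_inv n (Psi n E x) \<inter> tubing_inv n (Psi n E y)"
proof
  have "perm_inv n m \<subseteq> perm_inv n x" "perm_inv n m \<subseteq> perm_inv n y" using glb[OF m] by blast+
  then have "tubing_inv n (Psi n E m) \<subseteq> tubing_inv n (Psi n E x)"
    "tubing_inv n (Psi n E m) \<subseteq> tubing_inv n (Psi n E y)"
    using tubing_inv_Psi_mono[OF sym rf] m x y by blast+
  then show "tubing_inv n Z \<subseteq> tubing_inv n (Psi n E x) \<inter> tubing_inv n (Psi n E y)"
    if "tubing_inv n Z \<subseteq> tubing_inv n (Psi n E m)" using that by blast
next
  assume le: "tubing_inv n Z \<subseteq> tubing_inv n (Psi n E x) \<inter> tubing_inv n (Psi n E y)"
  obtain z where z: "z permutes {1..n}" "Psi n E z = Z" "perm_inv n z = tubing_inv n Z"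
    using maximal_tubing_G_permutation[OF sym rf Z] by blast
  have "perm_inv n z \<subseteq> perm_inv n x \<inter> perm_inv n y"
    using le tubing_inv_Psi_subset[OF sym x] tubing_inv_Psi_subset[OF sym y] z(3) by blast
  then have "perm_inv n z \<subseteq> perm_inv n m" using glb[OF z(1)] by blast
  then show "tubing_inv n Z \<subseteq> tubing_inv n (Psi n E m)"
    using tubing_inv_Psi_mono[OF sym rf z(1) m] z(2) by simp
qed

lemma tubing_poset_represented:
  shows "eq (tubing_poset n E) = (=)"
    and "inj_on (tubing_inv n) (carrier (tubing_poset n E))"
    and "\<And>X Y. \<lbrakk>X \<in> carrier (tubing_poset n E); Y \<in> carrier (tubing_poset n E)\<rbrakk> \<Longrightarrow>
      X \<sqsubseteq>\<^bsub>tubing_poset n E\<^esub> Y \<longleftrightarrow> tubing_inv n X \<subseteq> tubing_inv n Y"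
  using tubing_inv_inject[OF sym rf] tubing_le_iff[OF sym rf]
  by (auto simp: tubing_poset_def intro!: inj_onI)

text \<open>Bounds are formed in the weak order from the \<open>G\<close>-permutations
  \<open>x\<close> and \<open>y\<close> of the two tubings and carried back by
  \<open>Psi\<close>.\<close>

lemma lattice_tubing_poset: "lattice (tubing_poset n E)"
proof (rule lattice_by_sets[OF tubing_poset_represented])
  fix X Y assume "X \<in> carrier (tubing_poset n E)" "Y \<in> carrier (tubing_poset n E)"
  then have X: "maximal_tubing n E X" and Y: "maximal_tubing n E Y" by (simp_all add: tubing_poset_def)
  obtain x where x: "x permutes {1..n}" "Psi n E x = X" "perm_inv n x = tubing_inv n X"
    using maximal_tubing_G_permutation[OF sym rf X] by blast
  obtain y where y: "y permutes {1..n}" "Psi n E y = Y" "perm_inv n y = tubing_inv n Y"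
    using maximal_tubing_G_permutation[OF sym rf Y] by blast
  obtain m where m: "m permutes {1..n}" "\<forall>z. z permutes {1..n} \<longrightarrow>
      (perm_inv n z \<subseteq> perm_inv n m \<longleftrightarrow> perm_inv n z \<subseteq> perm_inv n x \<inter> perm_inv n y)"
    by (rule weak_order_meet[OF x(1) y(1)])
  show "\<exists>M\<in>carrier (tubing_poset n E). \<forall>Z\<in>carrier (tubing_poset n E).
      tubing_inv n Z \<subseteq> tubing_inv n M \<longleftrightarrow> tubing_inv n Z \<subseteq> tubing_inv n X \<inter> tubing_inv n Y"
  proof (intro bexI[of _ "Psi n E m"] ballI)
    fix Z assume "Z \<in> carrier (tubing_poset n E)"
    then show "tubing_inv n Z \<subseteq> tubing_inv n (Psi n E m) \<longleftrightarrow>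
        tubing_inv n Z \<subseteq> tubing_inv n X \<inter> tubing_inv n Y"
      using tubing_inv_Psi_meet[OF m(1) x(1) y(1)] m(2) x(2) y(2) by (simp add: tubing_poset_def)
  qed (simp add: tubing_poset_def maximal_tubing_Psi[OF sym m(1)])
  obtain s where s: "s permutes {1..n}" "\<forall>z. z permutes {1..n} \<longrightarrow>
      (perm_inv n s \<subseteq> perm_inv n z \<longleftrightarrow> perm_inv n x \<union> perm_inv n y \<subseteq> perm_inv n z)"
    by (rule weak_order_join[OF x(1) y(1)])
  show "\<exists>S\<in>carrier (tubing_poset n E). \<forall>Z\<in>carrier (tubing_poset n E).
      tubing_inv n S \<subseteq> tubing_inv n Z \<longleftrightarrow> tubing_inv n X \<union> tubing_inv n Y \<subseteq> tubing_inv n Z"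
  proof (intro bexI[of _ "Psi n E s"] ballI)
    fix Z assume "Z \<in> carrier (tubing_poset n E)"
    then have Z: "maximal_tubing n E Z" by (simp add: tubing_poset_def)
    obtain z where z: "z permutes {1..n}" "Psi n E z = Z" "perm_inv n z = tubing_inv n Z"
      using maximal_tubing_G_permutation[OF sym rf Z] by blast
    show "tubing_inv n (Psi n E s) \<subseteq> tubing_inv n Z \<longleftrightarrow>
        tubing_inv n X \<union> tubing_inv n Y \<subseteq> tubing_inv n Z"
    proof
      have "perm_inv n x \<subseteq> perm_inv n s" "perm_inv n y \<subseteq> perm_inv n s" using s by blast+
      then have "tubing_inv n X \<subseteq> tubing_inv n (Psi n E s)"
        "tubing_inv n Y \<subseteq> tubing_inv n (Psi n E s)"
        using tubing_inv_Psi_mono[OF sym rf x(1) s(1)] tubing_inv_Psi_mono[OF sym rf y(1) s(1)] x y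
        by simp_all
      then show "tubing_inv n X \<union> tubing_inv n Y \<subseteq> tubing_inv n Z"
        if "tubing_inv n (Psi n E s) \<subseteq> tubing_inv n Z" using that by blast
    next
      \<comment> \<open>The chain is \<open>tubing_inv n (Psi n E s) \<subseteq> perm_inv n s
        \<subseteq> perm_inv n z = tubing_inv n Z\<close>.\<close>
      assume "tubing_inv n X \<union> tubing_inv n Y \<subseteq> tubing_inv n Z"
      then have "perm_inv n s \<subseteq> perm_inv n z" using s(2)[rule_format, OF z(1)] z(3) x(3) y(3) by simp
      then show "tubing_inv n (Psi n E s) \<subseteq> tubing_inv n Z"
        using tubing_inv_Psi_subset[OF sym s(1)] z(3) by blast
    qed
  qed (simp add: tubing_poset_def maximal_tubing_Psi[OF sym s(1)])
qed

lemma meet_pres_Psi: "meet_pres (weak_order n) (tubing_poset n E) (Psi n E)"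
  unfolding meet_pres_def
proof (intro conjI ballI lattice_weak_order lattice_tubing_poset)
  fix x y assume "x \<in> carrier (weak_order n)" "y \<in> carrier (weak_order n)"
  then have x: "x permutes {1..n}" and y: "y permutes {1..n}" by (simp_all add: weak_order_def)
  obtain m where m: "m permutes {1..n}" and glb: "\<forall>z. z permutes {1..n} \<longrightarrow>
      (perm_inv n z \<subseteq> perm_inv n m \<longleftrightarrow> perm_inv n z \<subseteq> perm_inv n x \<inter> perm_inv n y)"
    by (rule weak_order_meet[OF x y])
  have "x \<sqinter>\<^bsub>weak_order n\<^esub> y = m"
  proof (rule meet_by_sets[of _ "perm_inv n"])
    show "inj_on (perm_inv n) (carrier (weak_order n))"
      using perm_inv_inject by (intro inj_onI) (simp add: weak_order_def)
  qed (use x y m glb in \<open>simp_all add: weak_order_def\<close>)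
  moreover have "Psi n E x \<sqinter>\<^bsub>tubing_poset n E\<^esub> Psi n E y = Psi n E m"
  proof (rule meet_by_sets[OF tubing_poset_represented])
    fix Z assume "Z \<in> carrier (tubing_poset n E)"
    then show "tubing_inv n Z \<subseteq> tubing_inv n (Psi n E m) \<longleftrightarrow>
        tubing_inv n Z \<subseteq> tubing_inv n (Psi n E x) \<inter> tubing_inv n (Psi n E y)"
      using tubing_inv_Psi_meet[OF m x y] glb by (simp add: tubing_poset_def)
  qed (use maximal_tubing_Psi[OF sym] x y m in \<open>simp_all add: tubing_poset_def\<close>)
  ultimately show "Psi n E (x \<sqinter>\<^bsub>weak_order n\<^esub> y) =
      Psi n E x \<sqinter>\<^bsub>tubing_poset n E\<^esub> Psi n E y" by simp
qed

text \<open>On \<open>G\<close>-permutations \<open>Psi\<close> is injective, because such a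
  permutation shares its inversion set with its tubing, and it reaches every maximal tubing. The
  isomorphism is its inverse.\<close>

lemma tubing_poset_isomorphic:
  "poset_isomorphic (tubing_poset n E) ((weak_order n)\<lparr>carrier := {w. G_permutation n E w}\<rparr>)"
proof -
  let ?G = "{w. G_permutation n E w}" and ?M = "{X. maximal_tubing n E X}"
  have G: "w permutes {1..n}" "perm_inv n w = tubing_inv n (Psi n E w)" if "w \<in> ?G" for w
    using that G_permutation_iff_inv[OF sym _ rf] by (auto simp: G_permutation_def)
  have bij: "bij_betw (Psi n E) ?G ?M"
    unfolding bij_betw_def
  proof
    show "inj_on (Psi n E) ?G"
      using G perm_inv_inject by (intro inj_onI) metis
    show "Psi n E ` ?G = ?M"
    proof
      show "Psi n E ` ?G \<subseteq> ?M" using G(1) maximal_tubing_Psi[OF sym] by blast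
      show "?M \<subseteq> Psi n E ` ?G"
      proof
        fix X assume "X \<in> ?M"
        then obtain w where "w permutes {1..n}" "Psi n E w = X" "perm_inv n w = tubing_inv n X"
          using maximal_tubing_G_permutation[OF sym rf] by blast
        then show "X \<in> Psi n E ` ?G" using G_permutation_iff_inv[OF sym _ rf] by blast
      qed
    qed
  qed
  let ?g = "inv_into ?G (Psi n E)"
  have g: "?g X \<in> ?G" "Psi n E (?g X) = X" if "X \<in> ?M" for X
    using bij that bij_betw_inv_into_right[OF bij that] bij_betw_inv_into[OF bij]
    by (auto dest: bij_betwE)
  have "(flip n E)\<^sup>*\<^sup>* X Y \<longleftrightarrow> perm_inv n (?g X) \<subseteq> perm_inv n (?g Y)" if "X \<in> ?M" "Y \<in> ?M" for X Y
    using tubing_le_iff[OF sym rf] that G(2)[OF g(1)] g(2) by simp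
  then show ?thesis
    unfolding poset_isomorphic_def tubing_poset_def weak_order_def
    using bij_betw_inv_into[OF bij] by (intro exI[of _ ?g]) simp
qed

end

theorem theorem4p10:
  fixes n :: nat and E :: "nat rel"
  assumes "simple_graph n E" and "right_filled E"
  shows "(\<forall>T\<in>carrier (forest_order n E). \<forall>T'\<in>carrier (forest_order n E).
            T \<sqsubseteq>\<^bsub>forest_order n E\<^esub> T' \<longleftrightarrow> forest_inv T \<subseteq> forest_inv T')
    \<and> (poset_isomorphic (tubing_poset n E)
          ((weak_order n)\<lparr>carrier := {w. G_permutation n E w}\<rparr>)
       \<and> lattice (tubing_poset n E))
    \<and> (Psi n E \<in> carrier (weak_order n) \<rightarrow> carrier (tubing_poset n E)
       \<and> meet_pres (weak_order n) (tubing_poset n E) (Psi n E))"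
proof -
  have sym: "sym E" using assms(1) by (simp add: simple_graph_def)
  \<comment> \<open>Comparing forests means comparing their tubings, whose inversion sets are those
    of the forests.\<close>
  have "T \<sqsubseteq>\<^bsub>forest_order n E\<^esub> T' \<longleftrightarrow> forest_inv T \<subseteq> forest_inv T'"
    if "G_forest n E T" "G_forest n E T'" for T T'
    using tubing_le_iff[OF sym assms(2)] forest_tubing_maximal[OF sym] that
    by (simp add: forest_order_def tubing_poset_def)
  then have "\<forall>T\<in>carrier (forest_order n E). \<forall>T'\<in>carrier (forest_order n E).
      T \<sqsubseteq>\<^bsub>forest_order n E\<^esub> T' \<longleftrightarrow> forest_inv T \<subseteq> forest_inv T'"
    by (simp add: forest_order_def)
  moreover have "Psi n E \<in> carrier (weak_order n) \<rightarrow> carrier (tubing_poset n E)"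
    using maximal_tubing_Psi[OF sym] by (simp add: weak_order_def tubing_poset_def Pi_def)
  ultimately show ?thesis
    using tubing_poset_isomorphic lattice_tubing_poset meet_pres_Psi sym assms(2) by blast
qed

end
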